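(* Let $T>0$, let $p:[0,T]\to(1,\infty)$ be continuous with $p(0)=p(T)$, let $f:[0,\infty)\to\mathbb{R}$ and $g:(0,\infty)\to\mathbb{R}$ be continuous, and let $h:[0,T]\to\mathbb{R}$ be continuous. Put $\overline{h}:=\frac1T\int_0^T h(t)\,dt$. If there exists a constant $\alpha>0$ with $g(\alpha)\geq\max_{[0,T]}h$, and if $$\limsup_{x\to+\infty}g(x)<\overline{h},$$ then the periodic problem $$(\phi_{p(t)}(u'))'+f(u)u'+g(u)=h(t)\ \text{ in }[0,T],\qquad u(0)-u(T)=0=u'(0)-u'(T),$$ has at least one solution $u$ with $u(t)\geq\alpha$ for all $t\in[0,T]$.
   Context: For $t\in[0,T]$ and $x\in\mathbb{R}$, $\phi_{p(t)}(x)=|x|^{p(t)-2}x$ (with $\phi_{p(t)}(0)=0$). A solution of the problem is a function $u:[0,T]\to(0,\infty)$ of class $C^1$ with $u(0)=u(T)$, $u'(0)=u'(T)$, such that $t\mapsto\phi_{p(t)}(u'(t))$ is of class $C^1$ on $[0,T]$ and the differential equation holds at every $t\in[0,T]$. *)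

theory Defs
  imports "HOL-Analysis.Analysis"
begin

text \<open>Since \<open>0 powr a = 0\<close> and the last factor is \<open>x\<close>, the value at \<open>x = 0\<close> is \<open>0\<close> for every \<open>q\<close>.\<close>

definition phi :: "real \<Rightarrow> real \<Rightarrow> real" where
  "phi q x = \<bar>x\<bar> powr (q - 2) * x"

text \<open>Functions on an interval \<open>[a,b]\<close> are total functions of which only the values on \<open>[a,b]\<close>
  matter; being of class \<open>C\<^sup>1\<close> on \<open>[a,b]\<close> uses one-sided derivatives at the end points
  (\<open>C1_differentiable_on\<close> of the library would need two-sided ones).\<close>

definition C1_with_deriv :: "real \<Rightarrow> real \<Rightarrow> (real \<Rightarrow> real) \<Rightarrow> (real \<Rightarrow> real) \<Rightarrow> bool" where
  "C1_with_deriv a b v v' \<longleftrightarrow>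
     (\<forall>t\<in>{a..b}. (v has_real_derivative v' t) (at t within {a..b})) \<and> continuous_on {a..b} v'"

definition mean_value :: "real \<Rightarrow> (real \<Rightarrow> real) \<Rightarrow> real" where
  "mean_value T h = 1 / T * integral {0..T} h"

text \<open>On \<open>[0,T]\<close> with \<open>T > 0\<close> the functions \<open>u'\<close> and \<open>w\<close> are uniquely determined by \<open>u\<close>:
  they are the derivatives of \<open>u\<close> and of \<open>t \<mapsto> phi (p t) (u' t)\<close>.\<close>

definition periodic_solution ::
  "real \<Rightarrow> (real \<Rightarrow> real) \<Rightarrow> (real \<Rightarrow> real) \<Rightarrow> (real \<Rightarrow> real) \<Rightarrow> (real \<Rightarrow> real) \<Rightarrow> (real \<Rightarrow> real) \<Rightarrow> bool"
where
  "periodic_solution T p f g h u \<longleftrightarrow>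
     (\<forall>t\<in>{0..T}. u t > 0) \<and>
     (\<exists>u' w. C1_with_deriv 0 T u u' \<and>
             C1_with_deriv 0 T (\<lambda>t. phi (p t) (u' t)) w \<and>
             (\<forall>t\<in>{0..T}. w t + f (u t) * u' t + g (u t) = h t) \<and>
             u 0 - u T = 0 \<and> u' 0 - u' T = 0)"

end

theory Submission
  imports Defs "HOL-Complex_Analysis.Great_Picard"
begin

text \<open>
  Let \<open>G' = f\<close> and \<open>y = phi (p t) u' + G u\<close>. The equation becomes the first-order system
  \<open>u' = s (y - G u)\<close>, \<open>y' = h t - g u\<close>, where \<open>s\<close> is the inverse of \<open>phi (p t)\<close>, and
  \<open>u' 0 = u' T\<close> follows from \<open>y 0 = y T\<close> and \<open>u 0 = u T\<close> because \<open>p 0 = p T\<close>.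

  Below the constant lower solution \<open>\<alpha>\<close> the functions are modified: \<open>G u\<close> is replaced by
  \<open>G (max u \<alpha>)\<close>, which removes the damping there, and \<open>g u\<close> by \<open>g (max u \<alpha>) + max 0 (\<alpha> - u)\<close>. At a minimum of \<open>u\<close> below \<open>\<alpha>\<close>
  one would have \<open>u' = 0\<close> and, right after it, \<open>y' < 0\<close> with \<open>G\<close> constant, so that \<open>u\<close> would go on
  decreasing (\<open>periodic_minimum_principle\<close>). Hence a periodic solution of the modified system stays
  above \<open>\<alpha>\<close> and solves the original problem.

  The modified system is solvable because it is coercive. Multiply the equation by \<open>u\<close> and
  integrate: the term \<open>f u u' u\<close> contributes nothing over a period, and what remains is
  \<open>\<integral> \<bar>u'\<bar> powr p + \<integral> (h - g u) u = 0\<close>. As \<open>p\<close> is bounded away from 1, the first integral controls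
  every multiple of the total variation of \<open>u\<close>. If \<open>u\<close> is large everywhere, then \<open>g u\<close> is below
  the mean of \<open>h\<close> by a fixed amount, and the second integral grows with \<open>u\<close>, up to a multiple of the
  variation; if \<open>u\<close> is very negative everywhere, the modification of \<open>g\<close> has the same effect; otherwise
  \<open>\<bar>u\<bar>\<close> is bounded by a constant plus the variation. So the solutions are bounded (\<open>energy_bound\<close>).

  To turn the bound into existence, the system is discretised on a grid of \<open>N\<close> points. The scheme
  replaces \<open>G u\<close> by its average over the segment between consecutive values, for which the
  cancellation above is exact. For a continuous map \<open>\<Phi>\<close> on a cube there
  is a point at which every component of \<open>\<Phi>\<close> vanishes or points inwards from a face of the cube
  (\<open>cube_variational_inequality\<close>, from Kuhn's combinatorial lemma, in which the dimension is a number and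
  not a type). For the residual \<open>\<Phi>\<close> of the scheme such a point has energy at most \<open>0\<close>, and by
  the energy estimate it is not on the boundary (\<open>discrete_periodic\<close>). The bounds do not depend on \<open>N\<close>, so by the
  theorem of Arzela and Ascoli a subsequence of the discrete solutions converges uniformly to a periodic
  solution of the system (\<open>lienard_system_periodic_solution\<close>).
\<close>

section \<open>Zeros of continuous maps on a cube of arbitrary dimension\<close>

lemma tendsto_coordinatewiseI:
  fixes f :: "'a \<Rightarrow> 'b \<Rightarrow> 'c::topological_space"
  assumes "\<And>j. ((\<lambda>m. f m j) \<longlongrightarrow> l j) F"
  shows "(f \<longlongrightarrow> l) F"
proof -
  have "limitin (product_topology (\<lambda>i::'b. euclidean) UNIV) f l F"
    using assms by (simp add: limitin_componentwise)
  then show ?thesis by (simp add: euclidean_product_topology)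
qed

text \<open>Points of \<open>n\<close>-space are sequences vanishing from index \<open>n\<close> on, so that \<open>n\<close> can be a variable.\<close>

definition cube :: "nat \<Rightarrow> real \<Rightarrow> (nat \<Rightarrow> real) set" where
  "cube n R = {x. (\<forall>i<n. \<bar>x i\<bar> \<le> R) \<and> (\<forall>i\<ge>n. x i = 0)}"

lemma compact_cube: "compact (cube n R)"
proof -
  have eq: "cube n R = (\<Pi>\<^sub>E i\<in>UNIV. if i < n then {-R..R} else {0})"
  proof (rule set_eqI)
    fix x :: "nat \<Rightarrow> real"
    show "x \<in> cube n R \<longleftrightarrow> x \<in> (\<Pi>\<^sub>E i\<in>UNIV. if i < n then {-R..R} else {0})"
      unfolding cube_def PiE_UNIV_domain Pi_iff mem_Collect_eq
      by (metis UNIV_I abs_le_iff atLeastAtMost_iff minus_le_iff not_less singleton_iff)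
  qed
  have "compactin (product_topology (\<lambda>i::nat. euclideanreal) UNIV) (\<Pi>\<^sub>E i\<in>UNIV. if i < n then {-R..R} else {0})"
    by (subst compactin_PiE) auto
  then show ?thesis
    by (simp add: eq euclidean_product_topology)
qed

text \<open>Kuhn's lemma, applied to the signs of the components of \<open>G\<close> on ever finer grids, yields small
  cells at whose corners every component takes both signs; by compactness the cells accumulate at a zero.\<close>

lemma poincare_miranda_cube:
  fixes G :: "(nat \<Rightarrow> real) \<Rightarrow> nat \<Rightarrow> real"
  assumes R: "R > 0"
    and cont: "\<And>i. i < n \<Longrightarrow> continuous_on (cube n R) (\<lambda>x. G x i)"
    and lower: "\<And>x i. x \<in> cube n R \<Longrightarrow> i < n \<Longrightarrow> x i = - R \<Longrightarrow> G x i \<le> 0"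
    and upper: "\<And>x i. x \<in> cube n R \<Longrightarrow> i < n \<Longrightarrow> x i = R \<Longrightarrow> G x i \<ge> 0"
  obtains x where "x \<in> cube n R" "\<And>i. i < n \<Longrightarrow> G x i = 0"
proof -
  have step: "\<exists>q\<in>cube n R. \<forall>i<n. \<exists>r\<in>cube n R. \<exists>s\<in>cube n R. G r i \<le> 0 \<and> G s i \<ge> 0 \<and>
       (\<forall>j. \<bar>r j - q j\<bar> \<le> 2 * R / Suc k) \<and> (\<forall>j. \<bar>s j - q j\<bar> \<le> 2 * R / Suc k)" for k :: nat
  proof -
    \<comment> \<open>\<open>z\<close> maps the grid \<open>{0..Suc k}\<close> in each of the \<open>n\<close> directions affinely onto \<open>{-R..R}\<close>.\<close>
    define z where "z x = (\<lambda>i. if i < n then 2 * R * real (x i) / Suc k - R else 0)" for x :: "nat \<Rightarrow> nat"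
    \<comment> \<open>The labels \<open>0\<close> and \<open>1\<close> stand for \<open>G \<le> 0\<close> and \<open>G \<ge> 0\<close>. On the faces Kuhn's lemma prescribes them, in accordance
      with the boundary conditions on \<open>G\<close>.\<close>
    define label where "label x i = (if x i = 0 \<or> (x i \<noteq> Suc k \<and> G (z x) i < 0) then 0 else 1::nat)" for x i
    have zin: "z x \<in> cube n R" if "\<And>i. i < n \<Longrightarrow> x i \<le> Suc k" for x
    proof -
      have "\<bar>2 * R * real (x i) / Suc k - R\<bar> \<le> R" if "i < n" for i
      proof -
        have "real (x i) / Suc k \<le> 1" using \<open>i < n\<close> \<open>\<And>i. i < n \<Longrightarrow> x i \<le> Suc k\<close>[of i]
          by (simp del: of_nat_Suc)
        then have "2 * R * (real (x i) / Suc k) \<le> 2 * R * 1"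
          using R by (intro mult_left_mono) auto
        moreover have "2 * R * (real (x i) / Suc k) \<ge> 0" using R by simp
        ultimately show ?thesis by (simp add: abs_le_iff)
      qed
      then show ?thesis by (auto simp: cube_def z_def)
    qed
    have zdist: "\<bar>z r j - z q j\<bar> \<le> 2 * R / Suc k"
      if "\<forall>j<n. q j \<le> r j \<and> r j \<le> q j + 1" for r q j
    proof (cases "j < n")
      case True
      have "z r j - z q j = (2 * R / Suc k) * (real (r j) - real (q j))"
        by (simp add: z_def True right_diff_distrib)
      moreover have "\<bar>real (r j) - real (q j)\<bar> \<le> 1" using that True by force
      ultimately show ?thesis using R by (simp only: abs_mult) (use R in \<open>simp add: mult_left_le divide_right_mono\<close>)
    qed (use R in \<open>auto simp: z_def\<close>)
    have neg: "G (z x) i \<le> 0" if "label x i = 0" "i < n" "\<And>i. i < n \<Longrightarrow> x i \<le> Suc k" for x i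
    proof (cases "x i = 0")
      case True
      then show ?thesis using lower[OF zin[OF that(3)] that(2)] that(2) by (simp add: z_def)
    next
      case False
      then show ?thesis using that(1) by (simp add: label_def split: if_splits)
    qed
    have pos: "G (z x) i \<ge> 0" if "label x i = 1" "i < n" "\<And>i. i < n \<Longrightarrow> x i \<le> Suc k" for x i
    proof (cases "x i = Suc k")
      case True
      have "z x i = R" using that(2) by (simp add: z_def True field_simps)
      then show ?thesis using upper[OF zin[OF that(3)] that(2)] by simp
    next
      case False
      then show ?thesis using that(1) by (simp add: label_def split: if_splits)
    qed
    have l01: "label x i = 0 \<or> label x i = 1" for x i by (simp add: label_def)
    obtain q where q: "\<forall>i<n. q i < Suc k"
      "\<forall>i<n. \<exists>r s. (\<forall>j<n. q j \<le> r j \<and> r j \<le> q j + 1) \<and> (\<forall>j<n. q j \<le> s j \<and> s j \<le> q j + 1) \<and> label r i \<noteq> label s i"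
      by (rule kuhn_lemma[of "Suc k" n label]) (auto simp: label_def)
    show ?thesis
    proof (rule bexI[of _ "z q"]; (intro allI impI)?)
      fix i assume i: "i < n"
      obtain r s where rs: "\<forall>j<n. q j \<le> r j \<and> r j \<le> q j + 1" "\<forall>j<n. q j \<le> s j \<and> s j \<le> q j + 1"
        "label r i = 0" "label s i = 1"
      proof -
        obtain r s where rs: "\<forall>j<n. q j \<le> r j \<and> r j \<le> q j + 1" "\<forall>j<n. q j \<le> s j \<and> s j \<le> q j + 1"
          "label r i \<noteq> label s i" using q(2) i by blast
        show thesis
        proof (cases "label r i = 0")
          case True
          then show thesis using that[OF rs(1,2)] rs(3) l01[of s i] by simp
        next
          case False
          then show thesis using that[OF rs(2,1)] rs(3) l01[of s i] l01[of r i] by simp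
        qed
      qed
      have r: "r j \<le> Suc k" and s: "s j \<le> Suc k" if "j < n" for j
        using q(1) rs(1,2) that by force+
      show "\<exists>r\<in>cube n R. \<exists>s\<in>cube n R. G r i \<le> 0 \<and> G s i \<ge> 0 \<and>
       (\<forall>j. \<bar>r j - z q j\<bar> \<le> 2 * R / Suc k) \<and> (\<forall>j. \<bar>s j - z q j\<bar> \<le> 2 * R / Suc k)"
                by (rule bexI[of _ "z r"], rule bexI[of _ "z s"])
          (intro conjI allI zin r s neg[OF rs(3) i] pos[OF rs(4) i] zdist[OF rs(1)] zdist[OF rs(2)]; assumption)+
    next
      show "z q \<in> cube n R" by (rule zin) (use q(1) in \<open>simp add: less_imp_le\<close>)
    qed
  qed
  define near where "near k q i \<longleftrightarrow> (\<exists>r\<in>cube n R. \<exists>s\<in>cube n R. G r i \<le> 0 \<and> G s i \<ge> 0 \<and>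
       (\<forall>j. \<bar>r j - q j\<bar> \<le> 2 * R / Suc k) \<and> (\<forall>j. \<bar>s j - q j\<bar> \<le> 2 * R / Suc k))" for k :: nat and q i
  have "\<forall>k. \<exists>q. q \<in> cube n R \<and> (\<forall>i<n. near k q i)"
    using step unfolding near_def by blast
  then obtain q where q: "\<And>k. q k \<in> cube n R" "\<And>k i. i < n \<Longrightarrow> near k (q k) i"
    by metis
  obtain x k where x: "x \<in> cube n R" and k: "strict_mono (k :: nat \<Rightarrow> nat)" and lim: "(q \<circ> k) \<longlonglongrightarrow> x"
    using seq_compactE[OF compact_imp_seq_compact[OF compact_cube] allI[of "\<lambda>k. q k \<in> cube n R"]] q(1) by blast
  have rate: "(\<lambda>m. 2 * R / Suc (k m)) \<longlonglongrightarrow> 0"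
  proof -
    have "(\<lambda>m. 2 * R * inverse (real (Suc m))) \<longlonglongrightarrow> 0"
      by (rule tendsto_mult_right_zero[OF LIMSEQ_inverse_real_of_nat])
    from LIMSEQ_subseq_LIMSEQ[OF this k] show ?thesis by (simp add: o_def field_simps)
  qed
  have conv: "r \<longlonglongrightarrow> x" if r: "\<And>m j. \<bar>r m j - q (k m) j\<bar> \<le> 2 * R / Suc (k m)" for r
  proof (rule tendsto_coordinatewiseI)
    fix j
    have "(\<lambda>m. q (k m) j) \<longlonglongrightarrow> x j" 
      using lim continuous_on_tendsto_compose[OF continuous_on_product_coordinates[of j], of "q \<circ> k" x]
      by (simp add: o_def)
    moreover have "(\<lambda>m. r m j - q (k m) j) \<longlonglongrightarrow> 0"
      by (rule Lim_null_comparison[OF _ rate]) (use r in auto)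
    ultimately show "(\<lambda>m. r m j) \<longlonglongrightarrow> x j"
      using tendsto_add by fastforce
  qed
  show ?thesis
  proof (rule that[OF x])
    fix i assume i: "i < n"
    obtain r s where rs: "\<And>m. r m \<in> cube n R" "\<And>m. s m \<in> cube n R" "\<And>m. G (r m) i \<le> 0" "\<And>m. G (s m) i \<ge> 0"
      "\<And>m j. \<bar>r m j - q (k m) j\<bar> \<le> 2 * R / Suc (k m)" "\<And>m j. \<bar>s m j - q (k m) j\<bar> \<le> 2 * R / Suc (k m)"
    proof -
      have "\<forall>m. \<exists>r s. r \<in> cube n R \<and> s \<in> cube n R \<and> G r i \<le> 0 \<and> G s i \<ge> 0 \<and>
        (\<forall>j. \<bar>r j - q (k m) j\<bar> \<le> 2 * R / Suc (k m)) \<and> (\<forall>j. \<bar>s j - q (k m) j\<bar> \<le> 2 * R / Suc (k m))"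
        using q(2)[OF i] unfolding near_def by blast
      then show thesis using that by metis
    qed
    have "(\<lambda>m. G (r m) i) \<longlonglongrightarrow> G x i" "(\<lambda>m. G (s m) i) \<longlonglongrightarrow> G x i"
      using continuous_on_tendsto_compose[OF cont[OF i] conv x] rs by simp_all
    then show "G x i = 0"
      using rs(3,4) by (meson LIMSEQ_le_const LIMSEQ_le_const2 order_antisym)
  qed
qed

text \<open>The point is a fixed point of \<open>x \<mapsto> proj (x - F x)\<close>, where \<open>proj\<close> clips every coordinate to
  \<open>[-R, R]\<close>: a coordinate at which \<open>F\<close> does not vanish is one that was clipped. The purpose is that the inner product
  of \<open>F x\<close> and \<open>x\<close> is at most \<open>0\<close>.\<close>

lemma cube_variational_inequality:
  fixes F :: "(nat \<Rightarrow> real) \<Rightarrow> nat \<Rightarrow> real"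
  assumes R: "R > 0"
    and cont: "\<And>i. i < n \<Longrightarrow> continuous_on (cube n R) (\<lambda>x. F x i)"
  obtains x where "x \<in> cube n R" 
    "\<And>i. i < n \<Longrightarrow> F x i = 0 \<or> \<bar>x i\<bar> = R \<and> F x i * x i \<le> 0"
proof -
  define G where "G x i = x i - max (-R) (min R (x i - F x i))" for x i
  obtain x where x: "x \<in> cube n R" "\<And>i. i < n \<Longrightarrow> G x i = 0"
  proof (rule poincare_miranda_cube[OF R, of n G])
    show "continuous_on (cube n R) (\<lambda>x. G x i)" if "i < n" for i
      unfolding G_def
      by (intro continuous_intros cont that continuous_on_subset[OF continuous_on_product_coordinates]) auto
  qed (use R in \<open>auto simp: G_def\<close>)
  show ?thesis
  proof (rule that[OF x(1)])
    fix i assume "i < n"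
    then have "x i = max (-R) (min R (x i - F x i))" using x(2)[of i] by (simp add: G_def)
    then consider "F x i = 0" | "x i = R" "F x i \<le> 0" | "x i = -R" "F x i \<ge> 0"
      using R by (auto simp: max_def min_def split: if_splits)
    then show "F x i = 0 \<or> \<bar>x i\<bar> = R \<and> F x i * x i \<le> 0"
      using R by cases (auto simp: mult_le_0_iff)
  qed
qed

section \<open>Odd powers and averages along segments\<close>

lemma bounded_on_real:
  fixes f :: "real \<Rightarrow> real"
  assumes "continuous_on {a..b} f"
  obtains M where "M \<ge> 0" "\<And>x. x \<in> {a..b} \<Longrightarrow> \<bar>f x\<bar> \<le> M"
proof -
  have "bounded (f ` {a..b})" by (intro compact_imp_bounded compact_continuous_image assms compact_Icc)
  then obtain M where "\<And>x. x \<in> {a..b} \<Longrightarrow> \<bar>f x\<bar> \<le> M" unfolding bounded_iff real_norm_def by blast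
  then show thesis by (intro that[of "\<bar>M\<bar>"]) fastforce+
qed

lemma uniformly_close_real:
  fixes f :: "real \<Rightarrow> real"
  assumes "continuous_on {a..b} f" "e > 0"
  obtains d where "d > 0" "\<And>x y. x \<in> {a..b} \<Longrightarrow> y \<in> {a..b} \<Longrightarrow> \<bar>y - x\<bar> < d \<Longrightarrow> \<bar>f y - f x\<bar> < e"
  using compact_uniformly_continuous[OF assms(1) compact_Icc] assms(2)
  unfolding uniformly_continuous_on_def dist_real_def by blast

text \<open>The odd power \<open>sgn s * \<bar>s\<bar> powr a\<close>. Written in this form it is visibly continuous in \<open>(a, s)\<close> for
  \<open>a > 0\<close>, also at \<open>s = 0\<close>.\<close>

definition signed_powr :: "real \<Rightarrow> real \<Rightarrow> real" where
  "signed_powr a s = max s 0 powr a - max (- s) 0 powr a"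

lemma continuous_on_signed_powr:
  assumes "continuous_on S f" "continuous_on S g" "\<And>x. x \<in> S \<Longrightarrow> f x > 0"
  shows "continuous_on S (\<lambda>x. signed_powr (f x) (g x))"
  unfolding signed_powr_def using assms by (intro continuous_intros continuous_on_powr') auto

lemma signed_powr_eq: "signed_powr a s = sgn s * \<bar>s\<bar> powr a"
  by (cases s "0::real" rule: linorder_cases) (auto simp: signed_powr_def max_def)

lemma abs_signed_powr: "\<bar>signed_powr a s\<bar> = \<bar>s\<bar> powr a"
  by (cases s "0::real" rule: linorder_cases) (auto simp: signed_powr_eq abs_mult)

lemma sgn_signed_powr: "sgn (signed_powr a s) = sgn s"
  by (cases s "0::real" rule: linorder_cases) (auto simp: signed_powr_eq sgn_mult)

lemma signed_powr_inverse: "a * b = 1 \<Longrightarrow> signed_powr a (signed_powr b s) = s"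
  by (subst signed_powr_eq) (simp add: abs_signed_powr sgn_signed_powr powr_powr mult.commute[of b a] sgn_mult_abs)

lemma signed_powr_mult_self: "signed_powr a s * s = \<bar>s\<bar> powr (a + 1)"
  by (cases s "0::real" rule: linorder_cases) (auto simp: signed_powr_eq powr_add)

lemma phi_eq_signed_powr: "phi r x = signed_powr (r - 1) x"
proof (cases "x = 0")
  case False
  then have "\<bar>x\<bar> powr (r - 1) = \<bar>x\<bar> powr (r - 2) * \<bar>x\<bar>"
    using powr_add[of "\<bar>x\<bar>" "r - 2" 1] by simp
  then show ?thesis unfolding phi_def signed_powr_eq by (simp add: sgn_mult_abs mult.left_commute abs_mult_sgn)
qed (simp add: phi_def signed_powr_eq)

lemma continuous_has_antiderivative:
  fixes F :: "real \<Rightarrow> real"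
  assumes "continuous_on UNIV F"
  obtains G where "\<And>x. (G has_real_derivative F x) (at x)"
proof -
  have "\<exists>G. \<forall>x. (G has_vector_derivative F x) (at x)"
    using einterval_antiderivative[of "-\<infinity>" "\<infinity>" F] assms by (auto simp: continuous_on_eq_continuous_at)
  then show thesis using that by (auto simp: has_real_derivative_iff_has_vector_derivative)
qed

definition segment_avg :: "(real \<Rightarrow> real) \<Rightarrow> real \<Rightarrow> real \<Rightarrow> real" where
  "segment_avg F a b = integral {0..1} (\<lambda>s. F (a + s * (b - a)))"

lemma continuous_on_segment_avg:
  assumes F: "continuous_on UNIV F" and f: "continuous_on S f" and g: "continuous_on S g"
  shows "continuous_on S (\<lambda>x. segment_avg F (f x) (g x))"
proof -
  have "continuous_on (S \<times> cbox 0 1) (\<lambda>(x, s). F (f x + s * (g x - f x)))"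
    unfolding case_prod_beta
    by (intro continuous_intros continuous_on_compose2[OF F] continuous_on_compose2[OF f]
        continuous_on_compose2[OF g]) auto
  from integral_continuous_on_param[OF this] show ?thesis
    by (simp add: segment_avg_def[abs_def])
qed

text \<open>The average is a discrete gradient of an antiderivative of \<open>F\<close>: summed around a closed polygon,
  the right-hand side telescopes to \<open>0\<close>.\<close>

lemma segment_avg_times_diff:
  assumes F: "continuous_on UNIV F"
  obtains G where "\<And>a b. segment_avg F a b * (b - a) = G b - G a"
proof -
  obtain G where G: "\<And>x. (G has_real_derivative F x) (at x)"
    using continuous_has_antiderivative[OF F] by blast
  have "segment_avg F a b * (b - a) = G b - G a" for a b
  proof -
    have "((\<lambda>s. F (a + s * (b - a)) * (b - a)) has_integral G (a + 1 * (b - a)) - G (a + 0 * (b - a))) {0..1}"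
    proof (rule fundamental_theorem_of_calculus)
      fix s :: real
      have "((\<lambda>s. G (a + s * (b - a))) has_real_derivative F (a + s * (b - a)) * (b - a)) (at s within {0..1})"
        by (rule DERIV_chain'[OF _ G]) (auto intro!: derivative_eq_intros)
      then show "((\<lambda>s. G (a + s * (b - a))) has_vector_derivative F (a + s * (b - a)) * (b - a)) (at s within {0..1})"
        by (simp add: has_real_derivative_iff_has_vector_derivative)
    qed simp
    then have "integral {0..1} (\<lambda>s. F (a + s * (b - a)) * (b - a)) = G b - G a"
      by (intro integral_unique) simp
    then show ?thesis by (simp add: segment_avg_def)
  qed
  then show thesis by (rule that)
qed

lemma segment_avg_near:
  assumes F: "continuous_on UNIV F" and near: "\<And>z. z \<in> closed_segment a b \<Longrightarrow> \<bar>F z - c\<bar> \<le> e"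
  shows "\<bar>segment_avg F a b - c\<bar> \<le> e"
proof -
  have int: "(\<lambda>s. F (a + s * (b - a))) integrable_on {0..1}"
    by (intro integrable_continuous_real continuous_on_compose2[OF F] continuous_intros) auto
  have "\<bar>F (a + s * (b - a)) - c\<bar> \<le> e" if "s \<in> {0..1}" for s
    using that by (intro near) (auto simp: in_segment algebra_simps intro!: exI[of _ s])
  note * = this
  have *: "c - e \<le> F (a + s * (b - a))" "F (a + s * (b - a)) \<le> c + e" if "s \<in> {0..1}" for s
    using that[THEN *] by (auto simp: abs_le_iff)
  have "integral {0..1} (\<lambda>s::real. c - e) \<le> segment_avg F a b"
    unfolding segment_avg_def by (rule integral_le) (use int * in auto)
  moreover have "segment_avg F a b \<le> integral {0..1} (\<lambda>s::real. c + e)"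
    unfolding segment_avg_def by (rule integral_le) (use int * in auto)
  ultimately show ?thesis by (simp add: abs_le_iff)
qed

section \<open>Energy estimate for closed polygons\<close>

text \<open>The constant \<open>C\<close> serves all exponents from \<open>1 + a\<close> on at once, which makes the estimate uniform in \<open>t\<close>
  when the exponent varies with \<open>t\<close>. It is found by splitting at the point where \<open>d powr a\<close> reaches \<open>K\<close>.\<close>

lemma powr_superlinear:
  fixes a K :: real
  assumes a: "a > 0"
  shows "\<exists>C\<ge>0. \<forall>e\<ge>a. \<forall>d\<ge>0. K * d \<le> d powr (e + 1) + C"
proof -
  define L where "L = max 1 (max K 1 powr (1 / a))"
  have "K * d \<le> d powr (e + 1) + max K 1 * L" if e: "e \<ge> a" and d: "d \<ge> 0" for e d
  proof (cases "d \<le> L")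
    case True
    have "K * d \<le> max K 1 * L" using True d by (intro mult_mono) (auto simp: L_def)
    moreover have "d powr (e + 1) \<ge> 0" by simp
    ultimately show ?thesis by linarith
  next
    case False
    then have d1: "d > 1" "d > max K 1 powr (1 / a)" by (auto simp: L_def)
    have "max K 1 = (max K 1 powr (1 / a)) powr a" using a by (simp add: powr_powr)
    also have "\<dots> \<le> d powr a" using d1 a by (intro powr_mono2) auto
    also have "\<dots> \<le> d powr e" using d1 e by (intro powr_mono) auto
    finally have "K * d \<le> d powr e * d" using d by (intro mult_right_mono) auto
    also have "\<dots> = d powr (e + 1)" using d1 by (simp add: powr_add)
    finally show ?thesis by (simp add: L_def add_increasing2)
  qed
  moreover have "max K 1 * L \<ge> 0" by (simp add: L_def)
  ultimately show ?thesis by blast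
qed

lemma oscillation_le_variation:
  fixes x :: "nat \<Rightarrow> real"
  assumes "i \<le> N" "j \<le> N"
  shows "\<bar>x i - x j\<bar> \<le> (\<Sum>k<N. \<bar>x (Suc k) - x k\<bar>)"
proof -
  have *: "\<bar>x j - x i\<bar> \<le> (\<Sum>k<N. \<bar>x (Suc k) - x k\<bar>)" if "i \<le> j" "j \<le> N" for i j
  proof -
    have "x j - x i = (\<Sum>k=i..<j. x (Suc k) - x k)" using that by (simp add: sum_Suc_diff')
    also have "\<bar>\<dots>\<bar> \<le> (\<Sum>k=i..<j. \<bar>x (Suc k) - x k\<bar>)" by (rule sum_abs)
    also have "\<dots> \<le> (\<Sum>k<N. \<bar>x (Suc k) - x k\<bar>)" using that by (intro sum_mono2) auto
    finally show ?thesis .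
  qed
  show ?thesis using *[of i j] *[of j i] assms by (cases "i \<le> j") (auto simp: abs_minus_commute)
qed

text \<open>The outcome of multiplying the scheme \<open>Y (i + 1) - Y i = k i - d * q (x i)\<close> by \<open>x i\<close> and summing by
  parts over a period; \<open>e i + 1\<close> is the exponent \<open>p\<close> at the node, \<open>d\<close> the mesh size and \<open>k i\<close> the
  integral of \<open>h\<close> over the \<open>i\<close>-th cell.\<close>

definition energy ::
  "nat \<Rightarrow> real \<Rightarrow> (nat \<Rightarrow> real) \<Rightarrow> (nat \<Rightarrow> real) \<Rightarrow> (real \<Rightarrow> real) \<Rightarrow> (nat \<Rightarrow> real) \<Rightarrow> real" where
  "energy N d e k q x =
     (\<Sum>i<N. d * \<bar>(x (Suc i) - x i) / d\<bar> powr (e i + 1)) + (\<Sum>i<N. (k i - d * q (x i)) * x i)"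

text \<open>With \<open>D\<close> the total variation of the polygon, the first sum of the energy is at least \<open>K * D - C * T\<close> for a
  \<open>K\<close> of our choice. If all \<open>x i\<close> lie above \<open>M\<close>, or all below \<open>- M\<close>, the second sum is at least a
  multiple of \<open>\<bar>x 0\<bar>\<close> minus a multiple of \<open>D\<close>. In the remaining case \<open>\<bar>x i\<bar> \<le> M + D\<close>, and the second
  sum is bounded below by an affine function of \<open>D\<close>. The value of \<open>K\<close> is such that \<open>K * D\<close> absorbs
  all these multiples of \<open>D\<close>. The constant \<open>B\<close> is chosen before \<open>N\<close>, the exponents and the forcing.\<close>

lemma energy_bound:
  fixes q :: "real \<Rightarrow> real"
  assumes T: "T > 0" and a: "a > 0" and eps: "\<epsilon> > 0" and M: "M \<ge> 0"
    and q: "continuous_on UNIV q"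
    and q_right: "\<And>x. x \<ge> M \<Longrightarrow> q x \<le> m - \<epsilon>"
    and q_left: "\<And>x. x \<le> - M \<Longrightarrow> q x \<ge> H + 1"
  obtains B where "B > 0"
    "\<And>N e k x. N > 0 \<Longrightarrow> (\<And>i. i < N \<Longrightarrow> e i \<ge> a) \<Longrightarrow> (\<And>i. i < N \<Longrightarrow> \<bar>k i\<bar> \<le> H * (T / real N)) \<Longrightarrow>
       sum k {..<N} = m * T \<Longrightarrow> x N = x 0 \<Longrightarrow> energy N (T / real N) e k q x \<le> 0 \<Longrightarrow>
       (\<And>i. i < N \<Longrightarrow> \<bar>x i\<bar> < B)"
proof -
  obtain Q where Q0: "Q \<ge> 0" and Q': "\<And>x. x \<in> {-M..M} \<Longrightarrow> \<bar>q x\<bar> \<le> Q"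
    using bounded_on_real continuous_on_subset[OF q subset_UNIV] by blast
  have Q: "\<bar>q x\<bar> \<le> Q" if "\<bar>x\<bar> \<le> M" for x using Q'[of x] that by (simp add: abs_le_iff)
  \<comment> \<open>The case distinction below needs \<open>K\<close> to exceed the coefficients of \<open>D\<close>: \<open>T * (2 * H + \<epsilon>)\<close>, \<open>T\<close> and
    \<open>2 * H * T\<close>.\<close>
  define K where "K = T * (2 * \<bar>H\<bar> + \<epsilon> + 1) + 1"
  obtain C where C: "C \<ge> 0" "\<And>e d. e \<ge> a \<Longrightarrow> d \<ge> 0 \<Longrightarrow> K * d \<le> d powr (e + 1) + C"
    using powr_superlinear[OF a, of K] by blast
  define C2 where "C2 = (\<bar>H\<bar> + Q) * M"
  define B1 where "B1 = C * T + T * (2 * \<bar>H\<bar> * M + C2)"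
  define B where "B = 1 + M + B1 + C * T + C / \<epsilon> + C"
  have C2: "C2 \<ge> 0" using Q0 M by (simp add: C2_def)
  have nonneg: "B1 \<ge> 0" "C * T \<ge> 0" "C / \<epsilon> \<ge> 0"
    using C(1) T M C2 eps by (auto simp: B1_def)
  show ?thesis
  proof (rule that)
    show "B > 0" using nonneg C(1) M by (simp add: B_def)
  next
    fix N e k x i0
    assume N: "N > 0" and e: "\<And>i. i < N \<Longrightarrow> e i \<ge> a" and k: "\<And>i. i < N \<Longrightarrow> \<bar>k i\<bar> \<le> H * (T / real N)"
      and sumk: "sum k {..<N} = m * T" and per: "x N = x 0"
      and energy: "energy N (T / real N) e k q x \<le> 0" and i0: "i0 < N"
    define d where "d = T / real N"
    have d: "d > 0" "real N * d = T" using N T by (auto simp: d_def)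
    define D where "D = (\<Sum>k<N. \<bar>x (Suc k) - x k\<bar>)"
    have D0: "D \<ge> 0" by (simp add: D_def sum_nonneg)
    have osc: "\<bar>x i - x j\<bar> \<le> D" if "i < N" "j < N" for i j
      unfolding D_def using that by (intro oscillation_le_variation) auto
    have H0: "H \<ge> 0" using k[OF i0] d by (smt (verit) d_def mult_less_0_iff)
    have k': "\<bar>k i\<bar> \<le> H * d" if "i < N" for i using k[OF that] by (simp add: d_def)
    have m: "\<bar>m\<bar> \<le> H"
    proof -
      have "\<bar>m * T\<bar> \<le> (\<Sum>i<N. \<bar>k i\<bar>)" unfolding sumk[symmetric] by (rule sum_abs)
      also have "\<dots> \<le> (\<Sum>i<N. H * d)" by (intro sum_mono k') auto
      also have "\<dots> = H * T" using d(2) by (simp add: mult.left_commute)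
      finally show ?thesis using T by (simp add: abs_mult)
    qed
    have kin: "(\<Sum>i<N. d * \<bar>(x (Suc i) - x i) / d\<bar> powr (e i + 1)) \<ge> K * D - C * T"
    proof -
      have "K * \<bar>x (Suc i) - x i\<bar> - d * C \<le> d * \<bar>(x (Suc i) - x i) / d\<bar> powr (e i + 1)" if "i < N" for i
      proof -
        have "d * (K * \<bar>(x (Suc i) - x i) / d\<bar>) \<le> d * (\<bar>(x (Suc i) - x i) / d\<bar> powr (e i + 1) + C)"
          using C(2)[OF e[OF that], of "\<bar>(x (Suc i) - x i) / d\<bar>"] d by (intro mult_left_mono) auto
        then show ?thesis using d by (simp add: field_simps)
      qed
      then have "(\<Sum>i<N. K * \<bar>x (Suc i) - x i\<bar> - d * C) \<le> (\<Sum>i<N. d * \<bar>(x (Suc i) - x i) / d\<bar> powr (e i + 1))"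
        by (intro sum_mono) auto
      moreover have "(\<Sum>i<N. K * \<bar>x (Suc i) - x i\<bar> - d * C) = K * D - real N * d * C"
        by (simp add: sum_subtractf D_def sum_distrib_left)
      ultimately show ?thesis using d(2) by (simp add: mult.commute)
    qed
    have main: "K * D - C * T + (\<Sum>i<N. (k i - d * q (x i)) * x i) \<le> 0"
      using energy kin unfolding energy_def d_def by linarith
    have KD: "K * D = 2 * H * T * D + \<epsilon> * T * D + T * D + D"
      using H0 by (simp add: K_def algebra_simps)
    consider (above) "\<forall>i<N. x i \<ge> M" | (below) "\<forall>i<N. x i \<le> - M"
      | (mixed) i j where "i < N" "x i < M" "j < N" "x j > - M"
      by (meson not_le)
    then show "\<bar>x i0\<bar> < B"
    proof cases
      case above
      have "(k i - d * (m - \<epsilon>)) * x 0 - d * ((2 * H + \<epsilon>) * D) \<le> (k i - d * q (x i)) * x i" if i: "i < N" for i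
      proof -
        have "\<bar>(k i - d * (m - \<epsilon>)) * (x i - x 0)\<bar> \<le> (d * (2 * H + \<epsilon>)) * D"
          unfolding abs_mult
        proof (intro mult_mono)
          have "\<bar>d * (m - \<epsilon>)\<bar> \<le> d * (H + \<epsilon>)" using d m eps by (auto simp: abs_mult)
          then show "\<bar>k i - d * (m - \<epsilon>)\<bar> \<le> d * (2 * H + \<epsilon>)" using k'[OF i] by (simp add: algebra_simps)
        qed (use osc i N d H0 eps in auto)
        moreover have "(k i - d * (m - \<epsilon>)) * x i \<le> (k i - d * q (x i)) * x i"
          using above i M d q_right[of "x i"] by (intro mult_right_mono) fastforce+
        ultimately show ?thesis by (simp add: algebra_simps abs_le_iff)
      qed
      then have "(\<Sum>i<N. (k i - d * (m - \<epsilon>)) * x 0 - d * ((2 * H + \<epsilon>) * D)) \<le> (\<Sum>i<N. (k i - d * q (x i)) * x i)"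
        by (intro sum_mono) auto
      moreover have "(\<Sum>i<N. (k i - d * (m - \<epsilon>)) * x 0 - d * ((2 * H + \<epsilon>) * D))
        = (sum k {..<N} - (real N * d) * (m - \<epsilon>)) * x 0 - (real N * d) * ((2 * H + \<epsilon>) * D)"
        by (simp add: sum_subtractf sum_distrib_right[symmetric] mult.assoc)
      ultimately have "\<epsilon> * T * x 0 - T * ((2 * H + \<epsilon>) * D) \<le> (\<Sum>i<N. (k i - d * q (x i)) * x i)"
        unfolding d(2) sumk by (simp add: algebra_simps)
      then have *: "T * D + D + \<epsilon> * T * x 0 \<le> C * T" using main KD by (simp add: algebra_simps)
      have x0: "x 0 \<ge> 0" using above N M by force
      have "T * D \<ge> 0" "\<epsilon> * T * x 0 \<ge> 0" using T D0 eps x0 by auto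
      then have "D \<le> C * T" "\<epsilon> * T * x 0 \<le> C * T" using * D0 by linarith+
      then have "\<epsilon> * x 0 \<le> C" using T by (simp add: mult.commute mult.left_commute)
      then have "x 0 \<le> C / \<epsilon>" using eps by (simp add: field_simps)
      moreover have "x i0 \<ge> 0" using above i0 M by force
      ultimately show ?thesis using osc[OF i0 N] \<open>D \<le> C * T\<close> nonneg C(1) M unfolding B_def by linarith
    next
      case below
      have "d * (- x 0 - D) \<le> (k i - d * q (x i)) * x i" if i: "i < N" for i
      proof -
        have "d * (H + 1) \<le> d * q (x i)" using d q_left[of "x i"] below i by (intro mult_left_mono) auto
        then have "d \<le> d * q (x i) - k i" using k'[OF i] by (simp add: algebra_simps abs_le_iff)
        then have "d * (- x i) \<le> (d * q (x i) - k i) * (- x i)"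
          using below i M by (intro mult_right_mono) fastforce+
        moreover have "d * (- x 0 - D) \<le> d * (- x i)" using d osc[OF i N] by (intro mult_left_mono) auto
        ultimately show ?thesis by (simp add: algebra_simps)
      qed
      then have "(\<Sum>i<N. d * (- x 0 - D)) \<le> (\<Sum>i<N. (k i - d * q (x i)) * x i)"
        by (intro sum_mono) auto
      moreover have "(\<Sum>i<N. d * (- x 0 - D)) = (real N * d) * (- x 0 - D)" by simp
      ultimately have "T * (- x 0 - D) \<le> (\<Sum>i<N. (k i - d * q (x i)) * x i)" unfolding d(2) by linarith
      then have *: "2 * H * T * D + \<epsilon> * T * D + D + T * (- x 0) \<le> C * T"
        using main KD by (simp add: algebra_simps)
      have x0: "x 0 \<le> 0" using below N M by force
      have "2 * H * T * D \<ge> 0" "\<epsilon> * T * D \<ge> 0" "T * (- x 0) \<ge> 0"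
        using T D0 eps x0 H0 by (auto intro: mult_nonneg_nonneg simp: mult_le_0_iff)
      then have "D \<le> C * T" "T * (- x 0) \<le> C * T" using * D0 by linarith+
      then have "- x 0 \<le> C" using T by (metis mult.commute mult_le_cancel_left_pos)
      moreover have "x i0 \<le> 0" using below i0 M by force
      ultimately show ?thesis using osc[OF i0 N] \<open>D \<le> C * T\<close> nonneg C(1) M unfolding B_def by linarith
    next
      case mixed
      have ub: "\<bar>x l\<bar> \<le> M + D" if l: "l < N" for l
        using osc[OF l mixed(1)] osc[OF l mixed(3)] mixed(2,4) by (simp add: abs_le_iff)
      have "- (d * (2 * H * (M + D) + C2)) \<le> (k i - d * q (x i)) * x i" if i: "i < N" for i
      proof -
        consider "x i \<ge> M" | "x i \<le> - M" | "\<bar>x i\<bar> \<le> M" by linarith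
        then have "- (d * (2 * H * \<bar>x i\<bar> + C2)) \<le> (k i - d * q (x i)) * x i"
        proof cases
          case 1
          have "d * q (x i) \<le> d * H" using q_right[OF 1] m eps d by (intro mult_left_mono) auto
          then have "- (2 * H * d) \<le> k i - d * q (x i)" using k'[OF i] by (simp add: abs_le_iff algebra_simps)
          then have "- (2 * H * d) * x i \<le> (k i - d * q (x i)) * x i" using 1 M by (intro mult_right_mono) auto
          moreover have "d * C2 \<ge> 0" using d C2 by simp
          ultimately show ?thesis using 1 M by (simp add: algebra_simps)
        next
          case 2
          have "d * (H + 1) \<le> d * q (x i)" using d q_left[OF 2] by (intro mult_left_mono) auto
          then have "k i - d * q (x i) \<le> 0" using k'[OF i] d by (simp add: algebra_simps abs_le_iff)
          then have "(k i - d * q (x i)) * x i \<ge> 0" using 2 M by (intro mult_nonpos_nonpos) auto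
          moreover have "d * (2 * H * \<bar>x i\<bar> + C2) \<ge> 0" using d H0 C2 by simp
          ultimately show ?thesis by linarith
        next
          case 3
          have "\<bar>d * q (x i)\<bar> \<le> d * Q" using Q[OF 3] d by (simp add: abs_mult)
          then have "\<bar>k i - d * q (x i)\<bar> \<le> d * (H + Q)" using k'[OF i] by (simp add: algebra_simps)
          then have "\<bar>(k i - d * q (x i)) * x i\<bar> \<le> d * (H + Q) * M"
            unfolding abs_mult using 3 d H0 Q0 by (intro mult_mono) auto
          then have "- (d * C2) \<le> (k i - d * q (x i)) * x i" using H0 by (simp add: C2_def algebra_simps abs_le_iff)
          moreover have "d * (2 * H * \<bar>x i\<bar>) \<ge> 0" using d H0 by simp
          ultimately show ?thesis unfolding distrib_left by linarith
        qed
        moreover have "d * (2 * H * \<bar>x i\<bar> + C2) \<le> d * (2 * H * (M + D) + C2)"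
          using d H0 ub[OF i] by (intro mult_left_mono add_mono mult_mono) auto
        ultimately show ?thesis by linarith
      qed
      then have "(\<Sum>i<N. - (d * (2 * H * (M + D) + C2))) \<le> (\<Sum>i<N. (k i - d * q (x i)) * x i)"
        by (intro sum_mono) auto
      moreover have "(\<Sum>i<N. - (d * (2 * H * (M + D) + C2))) = - ((real N * d) * (2 * H * (M + D) + C2))" by simp
      ultimately have "- (T * (2 * H * (M + D) + C2)) \<le> (\<Sum>i<N. (k i - d * q (x i)) * x i)" unfolding d(2) by linarith
      then have "\<epsilon> * T * D + T * D + D \<le> C * T + T * (2 * H * M + C2)" using main KD by (simp add: algebra_simps)
      moreover have "\<epsilon> * T * D \<ge> 0" "T * D \<ge> 0" using eps T D0 by auto
      ultimately have "D \<le> B1" using H0 by (simp add: B1_def)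
      then show ?thesis using ub[OF i0] nonneg C(1) M unfolding B_def by linarith
    qed
  qed
qed

section \<open>The discretised problem\<close>

text \<open>The scheme is semi-implicit: it says \<open>x (i + 1) - x i = d * s (Y (i + 1) - A)\<close> with \<open>s\<close> inverse to the odd power
  and \<open>A\<close> the average of \<open>F\<close> between \<open>x i\<close> and \<open>x (i + 1)\<close>. As an equation for the cyclic sequence
  \<open>x\<close> alone, its residual \<open>\<Phi>\<close> satisfies \<open>(\<Sum>i. \<Phi> i * x i) = energy\<close>. The point that the
  variational inequality supplies therefore has energy at most \<open>0\<close>, hence lies inside the cube, and \<open>\<Phi>\<close> vanishes there.\<close>

lemma discrete_periodic:
  fixes F q :: "real \<Rightarrow> real"
  assumes N: "N > 0" and d: "d > 0" and R: "R > 0" and e: "\<And>i. i < N \<Longrightarrow> e i > 0"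
    and F: "continuous_on UNIV F" and q: "continuous_on UNIV q"
    and bound: "\<And>x i. x N = x 0 \<Longrightarrow> energy N d e k q x \<le> 0 \<Longrightarrow> i < N \<Longrightarrow> \<bar>x i\<bar> < R"
  obtains x Y where "x N = x 0" "Y N = Y 0" "\<And>i. i < N \<Longrightarrow> \<bar>x i\<bar> < R"
    "\<And>i. i < N \<Longrightarrow> Y (Suc i) = signed_powr (e i) ((x (Suc i) - x i) / d) + segment_avg F (x i) (x (Suc i))"
    "\<And>i. i < N \<Longrightarrow> Y (Suc i) - Y i = k i - d * q (x i)"
proof -
  \<comment> \<open>\<open>W z i\<close> is \<open>Y (i + 1)\<close>; the cyclic predecessor of index \<open>0\<close> is \<open>N - 1\<close>, so \<open>Y 0 = Y N\<close>.\<close>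
  define per where "per z i = z (i mod N)" for z :: "nat \<Rightarrow> real" and i
  define W where "W z i = signed_powr (e i) ((per z (Suc i) - per z i) / d) + segment_avg F (per z i) (per z (Suc i))" for z i
  define Y where "Y z i = (case i of 0 \<Rightarrow> W z (N - 1) | Suc j \<Rightarrow> W z j)" for z i
  define \<Phi> where "\<Phi> z i = k i - d * q (per z i) - (Y z (Suc i) - Y z i)" for z i
  have contper: "continuous_on S (\<lambda>z. per z i)" for i S
    unfolding per_def by (rule continuous_on_subset[OF continuous_on_product_coordinates]) simp
  have contW: "continuous_on S (\<lambda>z. W z i)" if "i < N" for i S
    unfolding W_def
    by (intro continuous_intros continuous_on_signed_powr continuous_on_segment_avg F contper) (use e that d in auto)
  have contY: "continuous_on S (\<lambda>z. Y z i)" if "i \<le> N" for i S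
    using that N by (cases i) (auto simp: Y_def intro: contW)
  have "continuous_on (cube N R) (\<lambda>z. \<Phi> z i)" if "i < N" for i
    unfolding \<Phi>_def
    by (intro continuous_intros contY continuous_on_compose2[OF q contper]) (use that in auto)
  then obtain z where z: "\<And>i. i < N \<Longrightarrow> \<Phi> z i = 0 \<or> \<bar>z i\<bar> = R \<and> \<Phi> z i * z i \<le> 0"
    using cube_variational_inequality[OF R, of N \<Phi>] by metis
  define x where "x = per z"
  have xN: "x N = x 0" by (simp add: x_def per_def)
  have YN: "Y z N = Y z 0" using N by (cases N) (auto simp: Y_def)
  have xz: "x i = z i" if "i < N" for i using that by (simp add: x_def per_def)
  obtain G where G: "\<And>a b. segment_avg F a b * (b - a) = G b - G a" using segment_avg_times_diff[OF F] by metis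
  have YS: "Y z (Suc i) = signed_powr (e i) ((x (Suc i) - x i) / d) + segment_avg F (x i) (x (Suc i))" for i
    by (simp add: Y_def W_def x_def)
  have work: "Y z (Suc i) * (x (Suc i) - x i) =
      d * \<bar>(x (Suc i) - x i) / d\<bar> powr (e i + 1) + (G (x (Suc i)) - G (x i))" for i
  proof -
    have "signed_powr (e i) ((x (Suc i) - x i) / d) * (x (Suc i) - x i) =
       d * (signed_powr (e i) ((x (Suc i) - x i) / d) * ((x (Suc i) - x i) / d))" using d by simp
    then show ?thesis unfolding YS distrib_right signed_powr_mult_self G by simp
  qed
  have "(\<Sum>i<N. (Y z (Suc i) - Y z i) * x i) =
      (\<Sum>i<N. (Y z (Suc i) * x (Suc i) - Y z i * x i) - Y z (Suc i) * (x (Suc i) - x i))"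
    by (intro sum.cong) (auto simp: algebra_simps)
  also have "\<dots> = (\<Sum>i<N. Y z (Suc i) * x (Suc i) - Y z i * x i)
      - (\<Sum>i<N. d * \<bar>(x (Suc i) - x i) / d\<bar> powr (e i + 1)) - (\<Sum>i<N. G (x (Suc i)) - G (x i))"
    unfolding sum_subtractf work sum.distrib by simp
  also have "(\<Sum>i<N. Y z (Suc i) * x (Suc i) - Y z i * x i) = 0"
    using sum_lessThan_telescope[of "\<lambda>i. Y z i * x i" N] by (simp add: xN YN)
  also have "(\<Sum>i<N. G (x (Suc i)) - G (x i)) = 0"
    using sum_lessThan_telescope[of "\<lambda>i. G (x i)" N] by (simp add: xN)
  finally have parts: "(\<Sum>i<N. (Y z (Suc i) - Y z i) * x i) =
      - (\<Sum>i<N. d * \<bar>(x (Suc i) - x i) / d\<bar> powr (e i + 1))" by simp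
  have "energy N d e k q x = (\<Sum>i<N. (k i - d * q (x i)) * x i) - (\<Sum>i<N. (Y z (Suc i) - Y z i) * x i)"
    unfolding parts by (simp add: energy_def)
  also have "\<dots> = (\<Sum>i<N. \<Phi> z i * x i)"
    unfolding sum_subtractf[symmetric] by (intro sum.cong) (auto simp: \<Phi>_def x_def algebra_simps)
  also have "\<dots> \<le> 0" by (intro sum_nonpos) (use z xz in fastforce)
  finally have xR: "\<bar>x i\<bar> < R" if "i < N" for i using bound[of x, OF xN] that by blast
  show thesis
  proof (rule that[of x "Y z"])
    show "Y z (Suc i) - Y z i = k i - d * q (x i)" if "i < N" for i
      using z[OF that] xR[OF that] xz[OF that] by (auto simp: \<Phi>_def x_def)
  qed (use xN YN xR YS in auto)
qed

lemma exists_nonneg_step: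
  fixes x :: "nat \<Rightarrow> real"
  assumes "N > 0" "x N = x 0"
  shows "\<exists>i<N. x (Suc i) - x i \<ge> 0"
proof (rule ccontr)
  assume "\<not> ?thesis"
  then have "(\<Sum>i<N. x (Suc i) - x i) < (\<Sum>i<N. 0)" using assms(1)
    by (intro sum_strict_mono) (auto simp: lessThan_empty_iff)
  then show False using assms(2) by (simp add: sum_lessThan_telescope)
qed

text \<open>Let \<open>Fm\<close> and \<open>Q\<close> bound \<open>\<bar>F\<bar>\<close> and \<open>\<bar>q\<bar>\<close> on \<open>[-B, B]\<close>. Then \<open>Y\<close> oscillates by at most
  \<open>(H + Q) * T\<close>. A closed polygon has a rising and a falling step, at which
  \<open>Y\<close> lies above \<open>- Fm\<close> and below \<open>Fm\<close>; so \<open>Y\<close> is bounded, and then so are the slopes.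
  The constants are independent of \<open>N\<close>.\<close>

lemma discrete_step_bounds:
  fixes F q :: "real \<Rightarrow> real"
  assumes F: "continuous_on UNIV F" and q: "continuous_on UNIV q" and a: "a > 0" and B: "B > 0" and H: "H \<ge> 0" and T: "T > 0"
  obtains C L where "C \<ge> 0" "L \<ge> 0"
    "\<And>N x Y e k. \<lbrakk>N > 0; x N = x 0; Y N = Y 0; \<And>i. i < N \<Longrightarrow> \<bar>x i\<bar> < B; \<And>i. i < N \<Longrightarrow> e i \<ge> a;
       \<And>i. i < N \<Longrightarrow> \<bar>k i\<bar> \<le> H * (T / real N);
       \<And>i. i < N \<Longrightarrow> Y (Suc i) = signed_powr (e i) ((x (Suc i) - x i) / (T / real N)) + segment_avg F (x i) (x (Suc i));
       \<And>i. i < N \<Longrightarrow> Y (Suc i) - Y i = k i - (T / real N) * q (x i)\<rbrakk> \<Longrightarrow>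
     (\<forall>i\<le>N. \<bar>Y i\<bar> \<le> C) \<and> (\<forall>i<N. \<bar>x (Suc i) - x i\<bar> \<le> L * (T / real N) \<and> \<bar>Y (Suc i) - Y i\<bar> \<le> L * (T / real N))"
proof -
  obtain Fm where Fm: "Fm \<ge> 0" "\<And>x. x \<in> {-B..B} \<Longrightarrow> \<bar>F x\<bar> \<le> Fm"
    using bounded_on_real continuous_on_subset[OF F subset_UNIV] by blast
  obtain Q where Q: "Q \<ge> 0" "\<And>x. x \<in> {-B..B} \<Longrightarrow> \<bar>q x\<bar> \<le> Q"
    using bounded_on_real continuous_on_subset[OF q subset_UNIV] by blast
  define C where "C = Fm + (H + Q) * T"
  define L where "L = max (H + Q) (max 1 (C + Fm) powr (1 / a))"
  show thesis
  proof (rule that)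
    show "C \<ge> 0" using Fm Q H T by (simp add: C_def)
    show "L \<ge> 0" by (simp add: L_def le_max_iff_disj)
  next
    fix N x Y e k
    assume N: "N > 0" and xN: "x N = x 0" and YN: "Y N = Y 0" and x: "\<And>i. i < N \<Longrightarrow> \<bar>x i\<bar> < B"
      and e: "\<And>i. i < N \<Longrightarrow> e i \<ge> a" and k: "\<And>i. i < N \<Longrightarrow> \<bar>k i\<bar> \<le> H * (T / real N)"
      and YS: "\<And>i. i < N \<Longrightarrow> Y (Suc i) = signed_powr (e i) ((x (Suc i) - x i) / (T / real N)) + segment_avg F (x i) (x (Suc i))"
      and dY: "\<And>i. i < N \<Longrightarrow> Y (Suc i) - Y i = k i - (T / real N) * q (x i)"
    define d where "d = T / real N"
    have d: "d > 0" "real N * d = T" using N T by (auto simp: d_def)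
    have xB: "\<bar>x i\<bar> \<le> B" if "i \<le> N" for i
      using x[of i] x[of 0] xN N that by (cases "i = N") auto
    have avg: "\<bar>segment_avg F (x i) (x (Suc i))\<bar> \<le> Fm" if "i < N" for i
    proof -
      have "\<bar>F z\<bar> \<le> Fm" if "z \<in> closed_segment (x i) (x (Suc i))" for z
        using that xB[of i] xB[of "Suc i"] \<open>i < N\<close>
        by (intro Fm) (auto simp: closed_segment_eq_real_ivl abs_le_iff split: if_splits)
      then show ?thesis using segment_avg_near[OF F, of "x i" "x (Suc i)" 0 Fm] by simp
    qed
    have dYb: "\<bar>Y (Suc i) - Y i\<bar> \<le> (H + Q) * d" if "i < N" for i
    proof -
      have "\<bar>d * q (x i)\<bar> \<le> d * Q" using Q(2)[of "x i"] xB[of i] that d by (auto simp: abs_mult abs_le_iff)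
      then show ?thesis using k[OF that] unfolding dY[OF that] d_def[symmetric] by (simp add: algebra_simps)
    qed
    have "(\<Sum>i<N. \<bar>Y (Suc i) - Y i\<bar>) \<le> (\<Sum>i<N. (H + Q) * d)" using dYb by (intro sum_mono) auto
    also have "\<dots> = (H + Q) * T" using d(2) by (simp add: mult.left_commute)
    finally have osc: "\<bar>Y i - Y j\<bar> \<le> (H + Q) * T" if "i \<le> N" "j \<le> N" for i j
      using oscillation_le_variation[OF that, of Y] by linarith
    have sg: "signed_powr (e i) ((x (Suc i) - x i) / d) \<ge> 0" if "x (Suc i) - x i \<ge> 0" for i
      using that d by (simp add: signed_powr_eq)
    have sg': "signed_powr (e i) ((x (Suc i) - x i) / d) \<le> 0" if "x (Suc i) - x i \<le> 0" for i
      using that d by (auto simp: signed_powr_eq mult_le_0_iff sgn_le_0_iff divide_le_0_iff)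
    obtain i where i: "i < N" "x (Suc i) - x i \<ge> 0" using exists_nonneg_step[OF N xN] by blast
    obtain j where j: "j < N" "x (Suc j) - x j \<le> 0" using exists_nonneg_step[OF N, of "\<lambda>i. - x i"] xN by auto
    have "Y (Suc i) \<ge> - Fm" using YS[OF i(1)] sg[OF i(2)] avg[OF i(1)] by (simp add: d_def abs_le_iff)
    moreover have "Y (Suc j) \<le> Fm" using YS[OF j(1)] sg'[OF j(2)] avg[OF j(1)] by (simp add: d_def abs_le_iff)
    ultimately have YC: "\<bar>Y l\<bar> \<le> C" if "l \<le> N" for l
      using osc[OF that, of "Suc i"] osc[OF that, of "Suc j"] i(1) j(1) unfolding C_def abs_le_iff by linarith
    have "\<bar>x (Suc i) - x i\<bar> \<le> L * d" if i: "i < N" for i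
    proof -
      define s where "s = \<bar>(x (Suc i) - x i) / d\<bar>"
      have "s powr e i = \<bar>Y (Suc i) - segment_avg F (x i) (x (Suc i))\<bar>"
        unfolding s_def abs_signed_powr[symmetric] using YS[OF i] by (simp add: d_def)
      then have se: "s powr e i \<le> C + Fm" using YC[of "Suc i"] avg[OF i] i by linarith
      have "s \<le> max 1 (C + Fm) powr (1 / a)"
      proof (cases "s \<le> 1")
        case True
        have "1 \<le> max 1 (C + Fm) powr (1 / a)" using a by (intro ge_one_powr_ge_zero) auto
        then show ?thesis using True by linarith
      next
        case False
        have "s powr a \<le> s powr e i" using False e[OF i] by (intro powr_mono) auto
        then have "s powr a \<le> max 1 (C + Fm)" using se by linarith
        then have "(s powr a) powr (1 / a) \<le> max 1 (C + Fm) powr (1 / a)" using a by (intro powr_mono2) auto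
        then show ?thesis using False a by (simp add: powr_powr)
      qed
      then have "s \<le> L" by (simp add: L_def)
      then show ?thesis using d by (simp add: s_def field_simps)
    qed
    moreover have "(H + Q) * d \<le> L * d" using d by (intro mult_right_mono) (auto simp: L_def)
    ultimately show "(\<forall>i\<le>N. \<bar>Y i\<bar> \<le> C) \<and> (\<forall>i<N. \<bar>x (Suc i) - x i\<bar> \<le> L * (T / real N) \<and> \<bar>Y (Suc i) - Y i\<bar> \<le> L * (T / real N))"
      using YC dYb order_trans unfolding d_def[symmetric] by blast
  qed
qed

section \<open>From grid functions to differentiable functions\<close>

text \<open>McShane's extension: the lower envelope of the cones with slope \<open>L\<close> over the given values.\<close>

lemma lipschitz_extension_from_nodes:
  fixes x t :: "nat \<Rightarrow> real"
  assumes L: "L \<ge> 0" and lip: "\<And>i j. i \<le> N \<Longrightarrow> j \<le> N \<Longrightarrow> \<bar>x i - x j\<bar> \<le> L * \<bar>t i - t j\<bar>"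
  obtains U where "\<And>s r. \<bar>U s - U r\<bar> \<le> L * \<bar>s - r\<bar>" "\<And>i. i \<le> N \<Longrightarrow> U (t i) = x i"
proof -
  define U where "U s = (MIN i\<in>{..N}. x i + L * \<bar>s - t i\<bar>)" for s
  have le: "U s \<le> x i + L * \<bar>s - t i\<bar>" if "i \<le> N" for s i
    unfolding U_def using that by (intro Min_le) auto
  have att: "\<exists>i\<le>N. U s = x i + L * \<bar>s - t i\<bar>" for s
  proof -
    have "U s \<in> (\<lambda>i. x i + L * \<bar>s - t i\<bar>) ` {..N}" unfolding U_def by (intro Min_in) auto
    then show ?thesis by auto
  qed
  have one: "U s \<le> U r + L * \<bar>s - r\<bar>" for s r
  proof -
    obtain i where i: "i \<le> N" "U r = x i + L * \<bar>r - t i\<bar>" using att by blast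
    have "L * \<bar>s - t i\<bar> \<le> L * (\<bar>r - t i\<bar> + \<bar>s - r\<bar>)" using L by (intro mult_left_mono) auto
    then show ?thesis using le[OF i(1), of s] i(2) by (simp add: distrib_left)
  qed
  show thesis
  proof (rule that)
    show "\<bar>U s - U r\<bar> \<le> L * \<bar>s - r\<bar>" for s r
      using one[of s r] one[of r s] by (simp add: abs_le_iff abs_minus_commute)
    show "U (t i) = x i" if i: "i \<le> N" for i
    proof (rule antisym)
      show "U (t i) \<le> x i" using le[OF i, of "t i"] by simp
      obtain j where j: "j \<le> N" "U (t i) = x j + L * \<bar>t i - t j\<bar>" using att by blast
      then show "x i \<le> U (t i)" using lip[OF i j(1)] by simp
    qed
  qed
qed

lemma grid_lipschitz:
  fixes x :: "nat \<Rightarrow> real"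
  assumes d: "d \<ge> 0" and step: "\<And>i. i < N \<Longrightarrow> \<bar>x (Suc i) - x i\<bar> \<le> L * d" and ij: "i \<le> N" "j \<le> N"
  shows "\<bar>x i - x j\<bar> \<le> L * \<bar>real i * d - real j * d\<bar>"
proof -
  have *: "\<bar>x j - x i\<bar> \<le> L * (real j * d - real i * d)" if "i \<le> j" "j \<le> N" for i j
    using that
  proof (induction j rule: dec_induct)
    case (step m)
    then have "\<bar>x (Suc m) - x i\<bar> \<le> L * (real m * d - real i * d) + L * d" using assms(2)[of m] by simp
    then show ?case by (simp add: algebra_simps)
  qed simp
  show ?thesis
  proof (cases "i \<le> j")
    case True
    then have "real i * d \<le> real j * d" using d by (simp add: mult_right_mono)
    then show ?thesis using *[of i j] True ij by (simp only: abs_minus_commute[of "x i"] abs_minus_commute[of "real i * d"]) simp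
  next
    case False
    then have "real j * d \<le> real i * d" using d by (simp add: mult_right_mono)
    then show ?thesis using *[of j i] False ij by simp
  qed
qed

text \<open>Extend the grid functions to Lipschitz functions on the line and apply the theorem of Arzela and Ascoli to the
  pairs of extensions, which gives a common subsequence for both.\<close>

lemma grid_compactness:
  fixes x y :: "nat \<Rightarrow> nat \<Rightarrow> real" and N :: "nat \<Rightarrow> nat"
  assumes T: "T > 0" and L: "L \<ge> 0" and N: "\<And>n. N n > 0"
    and x: "\<And>n i. i < N n \<Longrightarrow> \<bar>x n (Suc i) - x n i\<bar> \<le> L * (T / N n)" "\<And>n. \<bar>x n 0\<bar> \<le> B"
    and y: "\<And>n i. i < N n \<Longrightarrow> \<bar>y n (Suc i) - y n i\<bar> \<le> L * (T / N n)" "\<And>n. \<bar>y n 0\<bar> \<le> B"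
  obtains u v r where "continuous_on {0..T} u" "continuous_on {0..T} v" "strict_mono (r :: nat \<Rightarrow> nat)"
    "\<And>e. e > 0 \<Longrightarrow> \<forall>\<^sub>F n in sequentially. \<forall>i\<le>N (r n). \<bar>x (r n) i - u (i * (T / N (r n)))\<bar> < e"
    "\<And>e. e > 0 \<Longrightarrow> \<forall>\<^sub>F n in sequentially. \<forall>i\<le>N (r n). \<bar>y (r n) i - v (i * (T / N (r n)))\<bar> < e"
proof -
  have ext: "\<exists>U. (\<forall>s t. \<bar>U s - U t\<bar> \<le> L * \<bar>s - t\<bar>) \<and> (\<forall>i\<le>N n. U (i * (T / N n)) = z i)"
    if "\<And>i. i < N n \<Longrightarrow> \<bar>z (Suc i) - z i\<bar> \<le> L * (T / N n)" for z n
  proof -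
    have "\<bar>z i - z j\<bar> \<le> L * \<bar>real i * (T / N n) - real j * (T / N n)\<bar>" if "i \<le> N n" "j \<le> N n" for i j
      using \<open>\<And>i. i < N n \<Longrightarrow> \<bar>z (Suc i) - z i\<bar> \<le> L * (T / N n)\<close> T that by (intro grid_lipschitz[of "T / N n" "N n"]) auto
    then obtain U where "\<And>s t. \<bar>U s - U t\<bar> \<le> L * \<bar>s - t\<bar>" "\<And>i. i \<le> N n \<Longrightarrow> U (i * (T / N n)) = z i"
      using lipschitz_extension_from_nodes[OF L, of "N n" z "\<lambda>i. i * (T / N n)"] by blast
    then show ?thesis by blast
  qed
  obtain U where U: "\<And>n s t. \<bar>U n s - U n t\<bar> \<le> L * \<bar>s - t\<bar>" "\<And>n i. i \<le> N n \<Longrightarrow> U n (i * (T / N n)) = x n i"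
    
  proof -
    have "\<forall>n. \<exists>U. (\<forall>s t. \<bar>U s - U t\<bar> \<le> L * \<bar>s - t\<bar>) \<and> (\<forall>i\<le>N n. U (i * (T / N n)) = x n i)"
      by (intro allI ext x(1))
    from choice[OF this] show thesis using that by blast
  qed
  obtain V where V: "\<And>n s t. \<bar>V n s - V n t\<bar> \<le> L * \<bar>s - t\<bar>" "\<And>n i. i \<le> N n \<Longrightarrow> V n (i * (T / N n)) = y n i"
    
  proof -
    have "\<forall>n. \<exists>U. (\<forall>s t. \<bar>U s - U t\<bar> \<le> L * \<bar>s - t\<bar>) \<and> (\<forall>i\<le>N n. U (i * (T / N n)) = y n i)"
      by (intro allI ext y(1))
    from choice[OF this] show thesis using that by blast
  qed
  have U0: "\<bar>U n s\<bar> \<le> B + L * T" and V0: "\<bar>V n s\<bar> \<le> B + L * T" if "s \<in> {0..T}" for n s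
  proof -
    have "L * s \<le> L * T" using that L by (intro mult_left_mono) auto
    then show "\<bar>U n s\<bar> \<le> B + L * T" "\<bar>V n s\<bar> \<le> B + L * T"
      using U(1)[of n s 0] U(2)[of 0 n] x(2)[of n] V(1)[of n s 0] V(2)[of 0 n] y(2)[of n] that by auto
  qed
  have nP: "norm (a, b) \<le> \<bar>a\<bar> + \<bar>b\<bar>" for a b :: real
    using norm_Pair_le[of a b] by simp
  obtain g r where g: "continuous_on {0..T} g" "strict_mono (r :: nat \<Rightarrow> nat)"
    "\<And>e. e > 0 \<Longrightarrow> \<exists>m. \<forall>n s. n \<ge> m \<and> s \<in> {0..T} \<longrightarrow> norm ((U (r n) s, V (r n) s) - g s) < e"
  proof (rule Arzela_Ascoli[of "{0..T}" "\<lambda>n s. (U n s, V n s)" "2 * (B + L * T)"])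
    show "norm (U n s, V n s) \<le> 2 * (B + L * T)" if "s \<in> {0..T}" for n s
    proof -
      have "norm (U n s, V n s) \<le> \<bar>U n s\<bar> + \<bar>V n s\<bar>" by (rule nP)
      also have "\<dots> \<le> (B + L * T) + (B + L * T)" by (intro add_mono U0 V0 that)
      finally show ?thesis by simp
    qed
    fix s e :: real assume "s \<in> {0..T}" "e > 0"
    show "\<exists>d>0. \<forall>n t. t \<in> {0..T} \<and> norm (s - t) < d \<longrightarrow> norm ((U n s, V n s) - (U n t, V n t)) < e"
    proof (intro exI[of _ "e / (2 * L + 1)"] conjI allI impI)
      show "e / (2 * L + 1) > 0" using \<open>e > 0\<close> L by simp
      fix n t assume t: "t \<in> {0..T} \<and> norm (s - t) < e / (2 * L + 1)"
      have "norm ((U n s, V n s) - (U n t, V n t)) \<le> \<bar>U n s - U n t\<bar> + \<bar>V n s - V n t\<bar>"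
        using nP[of "U n s - U n t" "V n s - V n t"] by simp
      also have "\<dots> \<le> 2 * L * \<bar>s - t\<bar>" using U(1)[of n s t] V(1)[of n s t] by simp
      also have "\<dots> \<le> (2 * L + 1) * \<bar>s - t\<bar>" by (simp add: distrib_right)
      also have "\<dots> < e" using t L by (simp add: field_simps)
      finally show "norm ((U n s, V n s) - (U n t, V n t)) < e" .
    qed
  qed auto
  have node: "real i * (T / N n) \<in> {0..T}" if "i \<le> N n" for i n
    using that N[of n] T by (auto simp: field_simps)
  have near: "\<bar>U (r n) s - fst (g s)\<bar> \<le> norm ((U (r n) s, V (r n) s) - g s)"
    "\<bar>V (r n) s - snd (g s)\<bar> \<le> norm ((U (r n) s, V (r n) s) - g s)" for n s
    using dist_fst_le[of "(U (r n) s, V (r n) s)" "g s"] dist_snd_le[of "(U (r n) s, V (r n) s)" "g s"]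
    by (simp_all add: dist_norm)
  show thesis
  proof (rule that[of "\<lambda>s. fst (g s)" "\<lambda>s. snd (g s)" r])
    fix e :: real assume "e > 0"
    then obtain m where m: "\<And>n s. n \<ge> m \<Longrightarrow> s \<in> {0..T} \<Longrightarrow> norm ((U (r n) s, V (r n) s) - g s) < e"
      using g(3) by blast
    show "\<forall>\<^sub>F n in sequentially. \<forall>i\<le>N (r n). \<bar>x (r n) i - fst (g (i * (T / N (r n))))\<bar> < e"
      unfolding eventually_sequentially
    proof (intro exI[of _ m] allI impI)
      fix n i assume "n \<ge> m" "i \<le> N (r n)"
      then show "\<bar>x (r n) i - fst (g (i * (T / N (r n))))\<bar> < e"
        using le_less_trans[OF near(1) m[OF _ node], of n i "r n"] U(2)[of i "r n"] by simp
    qed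
    show "\<forall>\<^sub>F n in sequentially. \<forall>i\<le>N (r n). \<bar>y (r n) i - snd (g (i * (T / N (r n))))\<bar> < e"
      unfolding eventually_sequentially
    proof (intro exI[of _ m] allI impI)
      fix n i assume "n \<ge> m" "i \<le> N (r n)"
      then show "\<bar>y (r n) i - snd (g (i * (T / N (r n))))\<bar> < e"
        using le_less_trans[OF near(2) m[OF _ node], of n i "r n"] V(2)[of i "r n"] by simp
    qed
  qed (use g in \<open>auto intro: continuous_on_fst continuous_on_snd\<close>)
qed

lemma integral_step_error:
  fixes v :: "real \<Rightarrow> real"
  assumes v: "continuous_on {0..T} v" and ab: "0 \<le> a" "a \<le> b" "b \<le> T"
    and near: "\<And>s. s \<in> {a..b} \<Longrightarrow> \<bar>v s - v a\<bar> \<le> e"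
  shows "\<bar>integral {0..b} v - integral {0..a} v - (b - a) * v a\<bar> \<le> e * (b - a)"
proof -
  have int: "v integrable_on {c..d}" if "0 \<le> c" "d \<le> T" for c d
    using that by (intro integrable_continuous_real continuous_on_subset[OF v]) auto
  have "integral {0..b} v = integral {0..a} v + integral {a..b} v"
    by (rule Henstock_Kurzweil_Integration.integral_combine[symmetric]) (use ab int in auto)
  moreover have "integral {a..b} (\<lambda>s. v a - e) \<le> integral {a..b} v"
    by (rule integral_le) (use int ab near in \<open>auto simp: abs_le_iff\<close>, force)
  moreover have "integral {a..b} v \<le> integral {a..b} (\<lambda>s. v a + e)"
    by (rule integral_le) (use int ab near in \<open>auto simp: abs_le_iff\<close>, force)
  ultimately show ?thesis using ab by (simp add: abs_le_iff algebra_simps)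
qed

lemma eventually_mesh_less:
  fixes N :: "nat \<Rightarrow> nat"
  assumes N: "\<And>n. N n > 0" "filterlim N at_top sequentially" and e: "e > 0"
  shows "\<forall>\<^sub>F n in sequentially. T / N n < e"
proof -
  have "\<forall>\<^sub>F n in sequentially. N n \<ge> nat \<lceil>T / e\<rceil> + 1"
    using N(2) by (simp add: filterlim_at_top)
  then show ?thesis
  proof eventually_elim
    case (elim n)
    then have "T / e < N n" by linarith
    then show ?case using e N(1)[of n] by (simp add: field_simps)
  qed
qed

text \<open>The grid function \<open>x n\<close> is the Euler polygon of an antiderivative \<open>V\<close> of \<open>v\<close>, up to an error of
  order \<open>e\<close> times the mesh size per step. These errors add up to at most \<open>2 * e * T\<close>, so that
  \<open>u - V\<close> is constant.\<close>

lemma grid_limit_has_derivative: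
  fixes x :: "nat \<Rightarrow> nat \<Rightarrow> real" and N :: "nat \<Rightarrow> nat"
  assumes T: "T > 0" and N: "\<And>n. N n > 0" "filterlim N at_top sequentially"
    and u: "continuous_on {0..T} u" and v: "continuous_on {0..T} v"
    and conv: "\<And>e. e > 0 \<Longrightarrow> \<forall>\<^sub>F n in sequentially. \<forall>i\<le>N n. \<bar>x n i - u (i * (T / N n))\<bar> < e"
    and incr: "\<And>e. e > 0 \<Longrightarrow> \<forall>\<^sub>F n in sequentially. \<forall>i<N n.
       \<bar>x n (Suc i) - x n i - T / N n * v (i * (T / N n))\<bar> \<le> e * (T / N n)"
    and t: "t \<in> {0..T}"
  shows "(u has_real_derivative v t) (at t within {0..T})"
proof -
  define V where "V s = integral {0..s} v" for s
  have V: "(V has_real_derivative v s) (at s within {0..T})" if "s \<in> {0..T}" for s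
    unfolding V_def by (rule integral_has_real_derivative[OF v that])
  define E where "E s = u s - V s - u 0" for s
  have contE: "continuous_on {0..T} E"
    unfolding E_def using V by (intro continuous_intros u)
      (meson DERIV_continuous continuous_on_eq_continuous_within)
  note mesh = eventually_mesh_less[OF N]
  have E0: "E s = 0" if s: "s \<in> {0..T}" for s
  proof (rule ccontr)
    assume ne: "E s \<noteq> 0"
    \<comment> \<open>Node errors are at most \<open>2 * e * T + 2 * e\<close>; passing from the nearest node to \<open>s\<close> costs another \<open>e\<close>.\<close>
    define e where "e = \<bar>E s\<bar> / (2 * T + 4)"
    have e: "e > 0" using ne T by (simp add: e_def)
    obtain d1 where d1: "d1 > 0" "\<And>a b. a \<in> {0..T} \<Longrightarrow> b \<in> {0..T} \<Longrightarrow> \<bar>b - a\<bar> < d1 \<Longrightarrow> \<bar>v b - v a\<bar> < e"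
      using compact_uniformly_continuous[OF v] e unfolding uniformly_continuous_on_def dist_real_def
      by (auto simp: compact_Icc)
    obtain d2 where d2: "d2 > 0" "\<And>a. a \<in> {0..T} \<Longrightarrow> \<bar>a - s\<bar> < d2 \<Longrightarrow> \<bar>E a - E s\<bar> < e"
      using contE e s unfolding continuous_on_iff dist_real_def by metis
    obtain n where n: "T / N n < d1" "T / N n < d2" "\<forall>i\<le>N n. \<bar>x n i - u (i * (T / N n))\<bar> < e"
      "\<forall>i<N n. \<bar>x n (Suc i) - x n i - T / N n * v (i * (T / N n))\<bar> \<le> e * (T / N n)"
      using eventually_conj[OF mesh[OF d1(1)] eventually_conj[OF mesh[OF d2(1)] eventually_conj[OF conv[OF e] incr[OF e]]]]
      by (blast dest: eventually_happens'[OF sequentially_bot])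
    define d where "d = T / N n"
    have d: "d > 0" "real (N n) * d = T" using T N(1)[of n] by (auto simp: d_def)
    have node: "real i * d \<in> {0..T}" if "i \<le> N n" for i
      using that d by (auto simp flip: d(2) intro!: mult_right_mono)
    have acc: "\<bar>x n i - x n 0 - V (i * d)\<bar> \<le> 2 * e * (i * d)" if "i \<le> N n" for i
      using that
    proof (induction i)
      case 0
      then show ?case by (simp add: V_def)
    next
      case (Suc i)
      have "\<bar>V (Suc i * d) - V (i * d) - (Suc i * d - i * d) * v (i * d)\<bar> \<le> e * (Suc i * d - i * d)"
        unfolding V_def
      proof (rule integral_step_error[OF v])
        fix a assume a: "a \<in> {i * d..Suc i * d}"
        then have "a \<in> {0..T}" using node[of i] node[of "Suc i"] Suc.prems by auto
        moreover have "\<bar>a - i * d\<bar> < d1" using a n(1) unfolding d_def[symmetric] by (auto simp: algebra_simps)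
        ultimately show "\<bar>v a - v (i * d)\<bar> \<le> e" using d1(2)[of "i * d" a] node[of i] Suc.prems by simp
      qed (use d node[of i] node[of "Suc i"] Suc.prems in \<open>auto simp: algebra_simps\<close>)
      then have "\<bar>V (Suc i * d) - V (i * d) - d * v (i * d)\<bar> \<le> e * d" by (simp add: algebra_simps)
      moreover have "\<bar>x n (Suc i) - x n i - d * v (i * d)\<bar> \<le> e * d" using n(4) Suc.prems by (simp add: d_def)
      ultimately have "\<bar>x n (Suc i) - x n 0 - V (Suc i * d)\<bar> \<le> 2 * e * (i * d) + 2 * (e * d)"
        using Suc.IH Suc.prems by linarith
      also have "\<dots> = 2 * e * (Suc i * d)" by (simp add: algebra_simps)
      finally show ?case .
    qed
    have EN: "\<bar>E (i * d)\<bar> \<le> 2 * e * T + 2 * e" if i: "i \<le> N n" for i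
    proof -
      have "2 * e * (i * d) \<le> 2 * e * T" using node[OF i] e by (intro mult_left_mono) auto
      moreover have "\<bar>x n i - u (i * d)\<bar> < e" "\<bar>x n 0 - u 0\<bar> < e"
        using n(3) i by (auto simp: d_def dest!: spec[of _ 0])
      ultimately show ?thesis using acc[OF i] unfolding E_def by linarith
    qed
    define i where "i = nat \<lfloor>s / d\<rfloor>"
    have fl: "real i = of_int \<lfloor>s / d\<rfloor>" using s d by (simp add: i_def)
    then have "real i \<le> s / d" "s / d < real i + 1" by linarith+
    then have id: "real i * d \<le> s" "s < real i * d + d" using d by (auto simp: field_simps)
    then have "real i * d \<le> real (N n) * d" using s d by auto
    then have iN: "i \<le> N n" using d(1) by (metis mult_le_cancel_right_pos of_nat_le_iff)
    have "\<bar>E (i * d) - E s\<bar> < e" using d2(2)[OF node[OF iN]] id n(2) unfolding d_def[symmetric] by linarith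
    then have "\<bar>E s\<bar> < 2 * e * T + 3 * e" using EN[OF iN] by linarith
    also have "\<dots> < e * (2 * T + 4)" using e by (simp add: algebra_simps)
    also have "\<dots> = \<bar>E s\<bar>" using T by (simp add: e_def)
    finally show False by simp
  qed
  have "((\<lambda>s. V s + u 0) has_real_derivative v t) (at t within {0..T})"
    using V[OF t] by (auto intro!: derivative_eq_intros)
  then show ?thesis
    by (rule has_field_derivative_transform_within[OF _ zero_less_one t]) (use E0 in \<open>force simp: E_def\<close>)
qed

section \<open>Periodic solutions of a first-order system\<close>

text \<open>The forcing \<open>k n i\<close> of the scheme is the exact integral of \<open>h\<close> over a cell, so that its sum over the
  period is \<open>T\<close> times the mean of \<open>h\<close>, as the energy estimate needs.
  After passage to a uniformly convergent subsequence the increments of both components are, up to \<open>o(d n)\<close>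
  uniformly in the node, \<open>d n\<close> times the right-hand sides at the left node, and
  \<open>grid_limit_has_derivative\<close> applies to each of them.\<close>

lemma lienard_system_periodic_solution:
  fixes p h F q :: "real \<Rightarrow> real" and T H M \<epsilon> :: real
  assumes T: "T > 0" and p: "continuous_on {0..T} p" "\<And>t. t \<in> {0..T} \<Longrightarrow> p t > 1"
    and h: "continuous_on {0..T} h" "\<And>t. t \<in> {0..T} \<Longrightarrow> \<bar>h t\<bar> \<le> H"
    and F: "continuous_on UNIV F" and q: "continuous_on UNIV q"
    and M: "M \<ge> 0" and eps: "\<epsilon> > 0"
    and right: "\<And>x. x \<ge> M \<Longrightarrow> q x \<le> mean_value T h - \<epsilon>"
    and left: "\<And>x. x \<le> - M \<Longrightarrow> q x \<ge> H + 1"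
  obtains u y where "u 0 = u T" "y 0 = y T"
    "\<And>t. t \<in> {0..T} \<Longrightarrow> (u has_real_derivative signed_powr (1 / (p t - 1)) (y t - F (u t))) (at t within {0..T})"
    "\<And>t. t \<in> {0..T} \<Longrightarrow> (y has_real_derivative h t - q (u t)) (at t within {0..T})"
proof -
  have H0: "H \<ge> 0" using h(2)[of 0] T by simp
  obtain t0 where t0: "t0 \<in> {0..T}" "\<And>t. t \<in> {0..T} \<Longrightarrow> p t0 \<le> p t"
    using continuous_attains_inf[OF compact_Icc _ p(1)] T by auto
  define a where "a = p t0 - 1"
  have a: "a > 0" using p(2) t0(1) by (simp add: a_def)
  define d where "d n = T / real (Suc n)" for n
  have d: "d n > 0" "real (Suc n) * d n = T" for n using T by (auto simp: d_def)
  have node: "real i * d n \<in> {0..T}" if "i \<le> Suc n" for i n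
    using that d[of n] by (auto simp flip: d(2)[of n] intro!: mult_right_mono)
  define e where "e n i = p (i * d n) - 1" for n i :: nat
  have e: "e n i \<ge> a" if "i < Suc n" for n i using t0(2) node[of i n] that by (simp add: e_def a_def)
  define k where "k n i = integral {0..Suc i * d n} h - integral {0..i * d n} h" for n i
  have k: "\<bar>k n i\<bar> \<le> H * d n" if "i < Suc n" for n i
  proof -
    have le: "i * d n \<le> Suc i * d n" using d(1)[of n] by simp
    have sub: "{i * d n..Suc i * d n} \<subseteq> {0..T}" using node[of i n] node[of "Suc i" n] that by auto
    have "k n i = integral {i * d n..Suc i * d n} h"
      unfolding k_def
      using Henstock_Kurzweil_Integration.integral_combine[of 0 "i * d n" "Suc i * d n" h] le node[of i n] node[of "Suc i" n] that
        integrable_continuous_real[OF continuous_on_subset[OF h(1), of "{0..Suc i * d n}"]] by auto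
    also have "\<bar>\<dots>\<bar> \<le> H * (Suc i * d n - i * d n)"
      using integral_bound[OF le continuous_on_subset[OF h(1) sub], of H] h(2) sub by auto
    finally show ?thesis by (simp add: algebra_simps)
  qed
  have sumk: "sum (k n) {..<Suc n} = mean_value T h * T" for n
    unfolding k_def using sum_lessThan_telescope[of "\<lambda>i. integral {0..i * d n} h" "Suc n"] d(2)[of n] T
    by (simp add: mean_value_def)
  obtain B where B: "B > 0"
    "\<And>N e k x i. N > 0 \<Longrightarrow> (\<And>i. i < N \<Longrightarrow> e i \<ge> a) \<Longrightarrow> (\<And>i. i < N \<Longrightarrow> \<bar>k i\<bar> \<le> H * (T / real N)) \<Longrightarrow>
       sum k {..<N} = mean_value T h * T \<Longrightarrow> x N = x 0 \<Longrightarrow> energy N (T / real N) e k q x \<le> 0 \<Longrightarrow>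
       i < N \<Longrightarrow> \<bar>x i\<bar> < B"
    using energy_bound[OF T a eps M q right left] by metis
  have "\<exists>x Y. x (Suc n) = x 0 \<and> Y (Suc n) = Y 0 \<and> (\<forall>i<Suc n. \<bar>x i\<bar> < B) \<and>
     (\<forall>i<Suc n. Y (Suc i) = signed_powr (e n i) ((x (Suc i) - x i) / d n) + segment_avg F (x i) (x (Suc i))) \<and>
     (\<forall>i<Suc n. Y (Suc i) - Y i = k n i - d n * q (x i))" for n
  proof (rule discrete_periodic[of "Suc n" "d n" B "e n" F q "k n"])
    show "\<bar>x i\<bar> < B" if "x (Suc n) = x 0" "energy (Suc n) (d n) (e n) (k n) q x \<le> 0" "i < Suc n" for x i
      using B(2)[of "Suc n" "e n" "k n" x i] e k sumk that by (simp add: d_def)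
    show "e n i > 0" if "i < Suc n" for i using e[OF that] a by linarith
    show ?thesis if "x (Suc n) = x 0" "Y (Suc n) = Y 0" "\<And>i. i < Suc n \<Longrightarrow> \<bar>x i\<bar> < B"
      "\<And>i. i < Suc n \<Longrightarrow> Y (Suc i) = signed_powr (e n i) ((x (Suc i) - x i) / d n) + segment_avg F (x i) (x (Suc i))"
      "\<And>i. i < Suc n \<Longrightarrow> Y (Suc i) - Y i = k n i - d n * q (x i)" for x Y
      using that by blast
  qed (use d B F q in auto)
  then obtain x Y where xY: "\<And>n. x n (Suc n) = x n 0" "\<And>n. Y n (Suc n) = Y n 0"
    "\<And>n i. i < Suc n \<Longrightarrow> \<bar>x n i\<bar> < B"
    "\<And>n i. i < Suc n \<Longrightarrow> Y n (Suc i) = signed_powr (e n i) ((x n (Suc i) - x n i) / d n) + segment_avg F (x n i) (x n (Suc i))"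
    "\<And>n i. i < Suc n \<Longrightarrow> Y n (Suc i) - Y n i = k n i - d n * q (x n i)"
    by metis
  obtain C L where CL: "C \<ge> 0" "L \<ge> 0" and
    CL': "\<And>N x Y e k. \<lbrakk>N > 0; x N = x 0; Y N = Y 0; \<And>i. i < N \<Longrightarrow> \<bar>x i\<bar> < B; \<And>i. i < N \<Longrightarrow> e i \<ge> a;
       \<And>i. i < N \<Longrightarrow> \<bar>k i\<bar> \<le> H * (T / real N);
       \<And>i. i < N \<Longrightarrow> Y (Suc i) = signed_powr (e i) ((x (Suc i) - x i) / (T / real N)) + segment_avg F (x i) (x (Suc i));
       \<And>i. i < N \<Longrightarrow> Y (Suc i) - Y i = k i - (T / real N) * q (x i)\<rbrakk> \<Longrightarrow>
     (\<forall>i\<le>N. \<bar>Y i\<bar> \<le> C) \<and> (\<forall>i<N. \<bar>x (Suc i) - x i\<bar> \<le> L * (T / real N) \<and> \<bar>Y (Suc i) - Y i\<bar> \<le> L * (T / real N))"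
    by (rule discrete_step_bounds[OF F q a B(1) H0 T]) blast
  have bounds: "(\<forall>i\<le>Suc n. \<bar>Y n i\<bar> \<le> C) \<and> (\<forall>i<Suc n. \<bar>x n (Suc i) - x n i\<bar> \<le> L * (T / real (Suc n)) \<and>
      \<bar>Y n (Suc i) - Y n i\<bar> \<le> L * (T / real (Suc n)))" for n
    by (rule CL'[of "Suc n" "x n" "Y n" "e n" "k n"])
      (assumption | rule zero_less_Suc xY[unfolded d_def] e k[unfolded d_def])+
  have YC: "\<bar>Y n i\<bar> \<le> C" if "i \<le> Suc n" for n i using bounds that by blast
  have dx: "\<bar>x n (Suc i) - x n i\<bar> \<le> L * d n" and dY: "\<bar>Y n (Suc i) - Y n i\<bar> \<le> L * d n" if "i < Suc n" for n i
    using bounds that unfolding d_def by blast+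
  have xB: "\<bar>x n i\<bar> \<le> B" if "i \<le> Suc n" for n i
    using xY(3)[of i n] xY(3)[of 0 n] xY(1)[of n] that by (cases "i = Suc n") auto
  obtain u v r where uv: "continuous_on {0..T} u" "continuous_on {0..T} v" "strict_mono (r :: nat \<Rightarrow> nat)" and
    cu: "\<And>e. e > 0 \<Longrightarrow> \<forall>\<^sub>F n in sequentially. \<forall>i\<le>Suc (r n). \<bar>x (r n) i - u (i * (T / Suc (r n)))\<bar> < e" and
    cv: "\<And>e. e > 0 \<Longrightarrow> \<forall>\<^sub>F n in sequentially. \<forall>i\<le>Suc (r n). \<bar>Y (r n) i - v (i * (T / Suc (r n)))\<bar> < e"
  proof (rule grid_compactness[of T L Suc x "max B C" Y])
    show "\<bar>x n 0\<bar> \<le> max B C" "\<bar>Y n 0\<bar> \<le> max B C" for n using xB[of 0 n] YC[of 0 n] by auto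
  qed (use T CL dx dY d_def in auto)
  have fN: "filterlim (\<lambda>n. Suc (r n)) at_top sequentially"
    using filterlim_compose[OF filterlim_Suc filterlim_subseq[OF uv(3)]] by simp
  have mesh: "\<forall>\<^sub>F n in sequentially. d (r n) < b" if "b > 0" for b
    using eventually_mesh_less[OF _ fN that, of T] by (simp add: d_def)
  note cu' = cu[unfolded d_def[symmetric]] and cv' = cv[unfolded d_def[symmetric]]
  obtain Bu where Bu: "Bu \<ge> 0" "\<And>t. t \<in> {0..T} \<Longrightarrow> \<bar>u t\<bar> \<le> Bu" using bounded_on_real[OF uv(1)] by blast
  define B2 where "B2 = max B Bu"
  have uB: "u t \<in> {-B2..B2}" if "t \<in> {0..T}" for t using Bu(2)[OF that] by (auto simp: B2_def abs_le_iff)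
  have xB2: "x n i \<in> {-B2..B2}" if "i \<le> Suc n" for n i using xB[OF that] by (auto simp: B2_def abs_le_iff)
  have seg: "closed_segment (x n i) (x n (Suc i)) \<subseteq> {-B2..B2}" if "i < Suc n" for n i
    using xB2[of i n] xB2[of "Suc i" n] that by (intro closed_segment_subset) auto
  have F2: "continuous_on {-B2..B2} F" and q2: "continuous_on {-B2..B2} q"
    using F q continuous_on_subset by blast+
  obtain Fm where Fm: "Fm \<ge> 0" "\<And>x. x \<in> {-B2..B2} \<Longrightarrow> \<bar>F x\<bar> \<le> Fm" using bounded_on_real[OF F2] by blast
  have avgF: "\<bar>segment_avg F (x n i) (x n (Suc i))\<bar> \<le> Fm" if "i < Suc n" for n i
    using segment_avg_near[OF F, of "x n i" "x n (Suc i)" 0 Fm] Fm(2) subsetD[OF seg[OF that]] by simp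
  obtain Bv where Bv: "Bv \<ge> 0" "\<And>t. t \<in> {0..T} \<Longrightarrow> \<bar>v t\<bar> \<le> Bv" using bounded_on_real[OF uv(2)] by blast
  define Z where "Z = max C Bv + Fm"
  have cFu: "continuous_on {0..T} (\<lambda>t. F (u t))"
    by (rule continuous_on_compose2[OF F uv(1)]) simp
  have cqu: "continuous_on {0..T} (\<lambda>t. q (u t))"
    by (rule continuous_on_compose2[OF q uv(1)]) simp
  have slope: "x n (Suc i) - x n i = d n * signed_powr (1 / e n i) (Y n (Suc i) - segment_avg F (x n i) (x n (Suc i)))"
    if "i < Suc n" for n i
    using xY(4)[OF that] e[OF that] a d(1)[of n] by (simp add: signed_powr_inverse)
  have Psi: "uniformly_continuous_on ({0..T} \<times> {-Z..Z}) (\<lambda>ts. signed_powr (1 / (p (fst ts) - 1)) (snd ts))"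
  proof (rule compact_uniformly_continuous)
    show "continuous_on ({0..T} \<times> {-Z..Z}) (\<lambda>ts. signed_powr (1 / (p (fst ts) - 1)) (snd ts))"
      by (intro continuous_on_signed_powr continuous_intros continuous_on_compose2[OF p(1)])
        (use p(2) in fastforce)+
  qed (auto intro: compact_Times)
  have incr_u: "\<forall>\<^sub>F n in sequentially. \<forall>i<Suc (r n).
     \<bar>x (r n) (Suc i) - x (r n) i - d (r n) * signed_powr (1 / (p (i * d (r n)) - 1)) (v (i * d (r n)) - F (u (i * d (r n))))\<bar>
       \<le> \<epsilon>' * d (r n)" if "\<epsilon>' > 0" for \<epsilon>'
  proof -
    \<comment> \<open>The argument of the odd power differs from its limit by less than \<open>\<eta>\<close>: the shift from \<open>Y i\<close> to \<open>Y (i + 1)\<close>,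
      the convergence of \<open>Y\<close> and the average of \<open>F\<close> contribute a quarter of \<open>\<eta>\<close> each.\<close>
    obtain \<eta> where eta: "\<eta> > 0" "\<And>t s s'. t \<in> {0..T} \<Longrightarrow> s \<in> {-Z..Z} \<Longrightarrow> s' \<in> {-Z..Z} \<Longrightarrow> \<bar>s' - s\<bar> < \<eta> \<Longrightarrow>
        \<bar>signed_powr (1 / (p t - 1)) s' - signed_powr (1 / (p t - 1)) s\<bar> < \<epsilon>'"
    proof -
      obtain \<eta> where eta: "\<eta> > 0" "\<And>ts ts'. ts \<in> {0..T} \<times> {-Z..Z} \<Longrightarrow> ts' \<in> {0..T} \<times> {-Z..Z} \<Longrightarrow> dist ts' ts < \<eta> \<Longrightarrow>
        dist (signed_powr (1 / (p (fst ts') - 1)) (snd ts')) (signed_powr (1 / (p (fst ts) - 1)) (snd ts)) < \<epsilon>'"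
        using Psi \<open>\<epsilon>' > 0\<close> unfolding uniformly_continuous_on_def by metis
      show thesis
      proof (rule that[OF eta(1)])
        fix t s s' assume "t \<in> {0..T}" "s \<in> {-Z..Z}" "s' \<in> {-Z..Z}" "\<bar>s' - s\<bar> < \<eta>"
        then show "\<bar>signed_powr (1 / (p t - 1)) s' - signed_powr (1 / (p t - 1)) s\<bar> < \<epsilon>'"
          using eta(2)[of "(t, s)" "(t, s')"] by (simp add: dist_Pair_Pair dist_real_def)
      qed
    qed
    obtain \<delta> where delta: "\<delta> > 0" "\<And>a b. a \<in> {-B2..B2} \<Longrightarrow> b \<in> {-B2..B2} \<Longrightarrow> \<bar>b - a\<bar> < \<delta> \<Longrightarrow> \<bar>F b - F a\<bar> < \<eta> / 4"
      using uniformly_close_real[OF F2, of "\<eta> / 4"] eta(1) by auto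
    have m0: "min (\<eta> / 4) (\<delta> / 2) / (L + 1) > 0" using eta(1) delta(1) CL by simp
    have ev: "\<forall>\<^sub>F n in sequentially. d (r n) < min (\<eta> / 4) (\<delta> / 2) / (L + 1) \<and>
      (\<forall>i\<le>Suc (r n). \<bar>x (r n) i - u (i * d (r n))\<bar> < \<delta> / 2) \<and>
      (\<forall>i\<le>Suc (r n). \<bar>Y (r n) i - v (i * d (r n))\<bar> < \<eta> / 4)"
      using mesh[OF m0] cu'[of "\<delta> / 2"] cv'[of "\<eta> / 4"] eta(1) delta(1) by (simp add: eventually_conj_iff)
    then show ?thesis
    proof eventually_elim
      case (elim n)
      have Ld: "L * d (r n) < \<eta> / 4" "L * d (r n) < \<delta> / 2"
      proof -
        have "(L + 1) * d (r n) < min (\<eta> / 4) (\<delta> / 2)" using elim CL by (simp add: field_simps)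
        then show "L * d (r n) < \<eta> / 4" "L * d (r n) < \<delta> / 2" using d(1)[of "r n"] by (auto simp: distrib_right)
      qed
      show ?case
      proof (intro allI impI)
        fix i assume i: "i < Suc (r n)"
        define t where "t = i * d (r n)"
        have t: "t \<in> {0..T}" using node[of i "r n"] i by (simp add: t_def)
        define A where "A = segment_avg F (x (r n) i) (x (r n) (Suc i))"
        have "\<bar>F z - F (u t)\<bar> \<le> \<eta> / 4" if z: "z \<in> closed_segment (x (r n) i) (x (r n) (Suc i))" for z
        proof -
          have "\<bar>z - x (r n) i\<bar> \<le> \<bar>x (r n) (Suc i) - x (r n) i\<bar>"
            using z by (auto simp: closed_segment_eq_real_ivl split: if_splits)
          moreover have "\<bar>x (r n) i - u t\<bar> < \<delta> / 2" using elim i by (simp add: t_def)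
          ultimately have "\<bar>z - u t\<bar> < \<delta>" using dx[OF i] Ld(2) by linarith
          then show ?thesis using delta(2)[OF uB[OF t], of z] seg[OF i] z by fastforce
        qed
        then have A: "\<bar>A - F (u t)\<bar> \<le> \<eta> / 4" unfolding A_def by (rule segment_avg_near[OF F])
        have "\<bar>Y (r n) i - v t\<bar> < \<eta> / 4" using elim i by (simp add: t_def)
        then have "\<bar>(Y (r n) (Suc i) - A) - (v t - F (u t))\<bar> < \<eta>" using A dY[OF i] Ld(1) eta(1) by linarith
        moreover have "Y (r n) (Suc i) - A \<in> {-Z..Z}"
          using YC[of "Suc i" "r n"] avgF[OF i] i unfolding Z_def A_def by (auto simp: abs_le_iff)
        moreover have "v t - F (u t) \<in> {-Z..Z}"
          using Bv(2)[OF t] Fm(2)[OF uB[OF t]] unfolding Z_def by (auto simp: abs_le_iff)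
        ultimately have "\<bar>signed_powr (1 / (p t - 1)) (Y (r n) (Suc i) - A) - signed_powr (1 / (p t - 1)) (v t - F (u t))\<bar> < \<epsilon>'"
          using eta(2)[OF t] by blast
        moreover have "x (r n) (Suc i) - x (r n) i - d (r n) * signed_powr (1 / (p t - 1)) (v t - F (u t)) =
          d (r n) * (signed_powr (1 / (p t - 1)) (Y (r n) (Suc i) - A) - signed_powr (1 / (p t - 1)) (v t - F (u t)))"
          unfolding slope[OF i] A_def e_def t_def by (simp add: right_diff_distrib)
        ultimately show "\<bar>x (r n) (Suc i) - x (r n) i - d (r n) * signed_powr (1 / (p (i * d (r n)) - 1)) (v (i * d (r n)) - F (u (i * d (r n))))\<bar>
           \<le> \<epsilon>' * d (r n)"
          using d(1)[of "r n"] unfolding t_def by (simp add: abs_mult mult.commute)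
      qed
    qed
  qed
  have incr_v: "\<forall>\<^sub>F n in sequentially. \<forall>i<Suc (r n).
     \<bar>Y (r n) (Suc i) - Y (r n) i - d (r n) * (h (i * d (r n)) - q (u (i * d (r n))))\<bar> \<le> \<epsilon>' * d (r n)"
    if "\<epsilon>' > 0" for \<epsilon>'
  proof -
    obtain \<eta> where eta: "\<eta> > 0" "\<And>a b. a \<in> {0..T} \<Longrightarrow> b \<in> {0..T} \<Longrightarrow> \<bar>b - a\<bar> < \<eta> \<Longrightarrow> \<bar>h b - h a\<bar> < \<epsilon>' / 2"
      using uniformly_close_real[OF h(1), of "\<epsilon>' / 2"] \<open>\<epsilon>' > 0\<close> by auto
    obtain \<delta> where delta: "\<delta> > 0" "\<And>a b. a \<in> {-B2..B2} \<Longrightarrow> b \<in> {-B2..B2} \<Longrightarrow> \<bar>b - a\<bar> < \<delta> \<Longrightarrow> \<bar>q b - q a\<bar> < \<epsilon>' / 2"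
      using uniformly_close_real[OF q2, of "\<epsilon>' / 2"] \<open>\<epsilon>' > 0\<close> by auto
    from mesh[OF eta(1)] cu'[OF delta(1)] show ?thesis
    proof eventually_elim
      case (elim n)
      show ?case
      proof (intro allI impI)
        fix i assume i: "i < Suc (r n)"
        define t where "t = i * d (r n)"
        have t: "t \<in> {0..T}" using node[of i "r n"] i by (simp add: t_def)
        have tS: "Suc i * d (r n) = t + d (r n)" by (simp add: t_def algebra_simps)
        have "\<bar>integral {0..t + d (r n)} h - integral {0..t} h - (t + d (r n) - t) * h t\<bar> \<le> \<epsilon>' / 2 * (t + d (r n) - t)"
        proof (rule integral_step_error[OF h(1)])
          show "t + d (r n) \<le> T" using node[of "Suc i" "r n"] i unfolding tS by auto
          then show "\<bar>h s - h t\<bar> \<le> \<epsilon>' / 2" if "s \<in> {t..t + d (r n)}" for s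
            using eta(2)[OF t, of s] that elim(1) t by fastforce
        qed (use t d(1)[of "r n"] in auto)
        then have kb: "\<bar>k (r n) i - d (r n) * h t\<bar> \<le> \<epsilon>' / 2 * d (r n)"
          unfolding k_def tS by (simp add: t_def)
        have "\<bar>q (x (r n) i) - q (u t)\<bar> < \<epsilon>' / 2"
          using delta(2)[OF uB[OF t] xB2[of i "r n"]] elim(2) i by (simp add: t_def)
        then have "\<bar>d (r n) * (q (x (r n) i) - q (u t))\<bar> \<le> d (r n) * (\<epsilon>' / 2)"
          using d(1)[of "r n"] by (simp add: abs_mult)
        then have "\<bar>(k (r n) i - d (r n) * q (x (r n) i)) - d (r n) * (h t - q (u t))\<bar> \<le> \<epsilon>' * d (r n)"
        proof -
          have "(k (r n) i - d (r n) * q (x (r n) i)) - d (r n) * (h t - q (u t)) =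
              (k (r n) i - d (r n) * h t) - d (r n) * (q (x (r n) i) - q (u t))"
            by (simp add: algebra_simps)
          moreover have "\<epsilon>' * d (r n) = \<epsilon>' / 2 * d (r n) + d (r n) * (\<epsilon>' / 2)" by simp
          ultimately show ?thesis
            using kb \<open>\<bar>d (r n) * (q (x (r n) i) - q (u t))\<bar> \<le> d (r n) * (\<epsilon>' / 2)\<close> by linarith
        qed
        then show "\<bar>Y (r n) (Suc i) - Y (r n) i - d (r n) * (h (i * d (r n)) - q (u (i * d (r n))))\<bar> \<le> \<epsilon>' * d (r n)"
          unfolding xY(5)[OF i] t_def .
      qed
    qed
  qed
  have per: "w 0 = w T" if z: "\<And>n. z n (Suc n) = z n 0"
    and cz: "\<And>e. e > 0 \<Longrightarrow> \<forall>\<^sub>F n in sequentially. \<forall>i\<le>Suc (r n). \<bar>z (r n) i - w (i * d (r n))\<bar> < e"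
    for z :: "nat \<Rightarrow> nat \<Rightarrow> real" and w :: "real \<Rightarrow> real"
  proof (rule ccontr)
    assume "w 0 \<noteq> w T"
    then have "\<bar>w 0 - w T\<bar> / 2 > 0" by simp
    from eventually_happens'[OF sequentially_bot cz[OF this]]
    obtain n where n: "\<And>i. i \<le> Suc (r n) \<Longrightarrow> \<bar>z (r n) i - w (i * d (r n))\<bar> < \<bar>w 0 - w T\<bar> / 2" by blast
    have half: "\<bar>z (r n) 0 - w 0\<bar> < \<bar>w 0 - w T\<bar> / 2" "\<bar>z (r n) 0 - w T\<bar> < \<bar>w 0 - w T\<bar> / 2"
      using n[of 0] n[of "Suc (r n)"] z[of "r n"] unfolding d(2) by auto
    have "\<bar>w 0 - w T\<bar> \<le> \<bar>z (r n) 0 - w 0\<bar> + \<bar>z (r n) 0 - w T\<bar>" by linarith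
    from le_less_trans[OF this add_strict_mono[OF half]] show False by simp
  qed
  show thesis
  proof (rule that[of u v])
    show "u 0 = u T" by (rule per[of x, OF xY(1) cu'])
    show "v 0 = v T" by (rule per[of Y, OF xY(2) cv'])
  next
    fix t assume t: "t \<in> {0..T}"
    show "(u has_real_derivative signed_powr (1 / (p t - 1)) (v t - F (u t))) (at t within {0..T})"
    proof (rule grid_limit_has_derivative[OF T _ fN uv(1) _ cu _ t, where v = "\<lambda>t. signed_powr (1 / (p t - 1)) (v t - F (u t))"])
      show "continuous_on {0..T} (\<lambda>t. signed_powr (1 / (p t - 1)) (v t - F (u t)))"
        by (intro continuous_on_signed_powr continuous_intros p(1) uv(2) cFu) (use p(2) in fastforce)+
    qed (use incr_u in \<open>simp_all add: d_def\<close>)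
    show "(v has_real_derivative h t - q (u t)) (at t within {0..T})"
    proof (rule grid_limit_has_derivative[OF T _ fN uv(2) _ cv _ t, where v = "\<lambda>t. h t - q (u t)"])
      show "continuous_on {0..T} (\<lambda>t. h t - q (u t))"
        by (intro continuous_intros h(1) cqu)
    qed (use incr_v in \<open>simp_all add: d_def\<close>)
  qed
qed

section \<open>Solutions above the lower solution\<close>

text \<open>For a system \<open>u' = v\<close> in which \<open>v\<close> has the sign of \<open>y - c\<close> while \<open>u\<close> is below the barrier. By
  periodicity a minimum may be placed at a point that has room to its right and at which the left-sided
  derivative argument still gives \<open>v \<le> 0\<close>; if the minimum is attained at the end points, the left-hand side
  is seen at \<open>T\<close> and the right-hand side at \<open>0\<close>. From there \<open>y\<close> falls below \<open>c\<close> and \<open>u\<close> decreases.\<close>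

lemma periodic_minimum_principle:
  fixes u v y y' :: "real \<Rightarrow> real"
  assumes T: "T > 0"
    and u: "\<And>t. t \<in> {0..T} \<Longrightarrow> (u has_real_derivative v t) (at t within {0..T})"
    and y: "\<And>t. t \<in> {0..T} \<Longrightarrow> (y has_real_derivative y' t) (at t within {0..T})"
    and per: "u 0 = u T" "v 0 = v T"
    and below: "\<And>t. t \<in> {0..T} \<Longrightarrow> u t < \<alpha> \<Longrightarrow> y' t < 0 \<and> sgn (v t) = sgn (y t - c)"
    and t: "t \<in> {0..T}"
  shows "u t \<ge> \<alpha>"
proof (rule ccontr)
  assume "\<not> u t \<ge> \<alpha>"
  have cu: "continuous_on {0..T} u" and cy: "continuous_on {0..T} y"
    using u y by (meson DERIV_continuous continuous_on_eq_continuous_within)+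
  obtain t0 where t0: "t0 \<in> {0..T}" "\<And>s. s \<in> {0..T} \<Longrightarrow> u t0 \<le> u s"
    using continuous_attains_inf[OF compact_Icc _ cu] T by auto
  have low: "u t0 < \<alpha>" using t0(2)[OF t] \<open>\<not> u t \<ge> \<alpha>\<close> by linarith
  have left: "v s \<le> 0" if s: "s \<in> {0<..T}" "u s = u t0" for s
  proof (rule ccontr)
    assume "\<not> v s \<le> 0"
    then obtain d where d: "d > 0" "\<And>k. k > 0 \<Longrightarrow> s - k \<in> {0..T} \<Longrightarrow> k < d \<Longrightarrow> u (s - k) < u s"
      using has_real_derivative_pos_inc_left[OF u[of s]] s by force
    define k where "k = min (d / 2) s"
    have "u (s - k) < u s" using d(1) s by (intro d(2)) (auto simp: k_def)
    moreover have "u t0 \<le> u (s - k)" using d(1) s by (intro t0(2)) (auto simp: k_def)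
    ultimately show False using s(2) by simp
  qed
  have "\<exists>s\<in>{0..<T}. u s = u t0 \<and> v s \<le> 0"
  proof (cases "0 < t0 \<and> t0 < T")
    case True
    then show ?thesis using left[of t0] by auto
  next
    case False
    then have "u 0 = u t0" using t0(1) per(1) by (cases "t0 = 0") auto
    then show ?thesis using left[of T] per T by (intro bexI[of _ 0]) auto
  qed
  then obtain s where s: "s \<in> {0..<T}" "u s = u t0" "v s \<le> 0" by blast
  obtain d where d: "d > 0" "\<And>r. r \<in> {0..T} \<Longrightarrow> \<bar>r - s\<bar> < d \<Longrightarrow> \<bar>u r - u s\<bar> < \<alpha> - u s"
    using cu s low unfolding continuous_on_iff dist_real_def
    by (metis atLeastAtMost_iff atLeastLessThan_iff diff_gt_0_iff_gt less_imp_le)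
  define b where "b = min T (s + d / 2)"
  have b: "s < b" "b \<le> T" using s(1) d(1) by (auto simp: b_def)
  have in_T: "r \<in> {0..T}" if "r \<in> {s..b}" for r using that b s(1) by auto
  have lower: "u r < \<alpha>" if "r \<in> {s..b}" for r
    using d(2)[OF in_T[OF that]] that d(1) by (fastforce simp: b_def)
  have interior: "at r within {0..T} = at r" if "s < r" "r < b" for r
    using that b s(1) by (intro at_within_Icc_at) auto
  have "y s \<le> c"
    using below[of s] lower[of s] b s by (auto simp: sgn_if split: if_splits)
  have y_less: "y r < c" if r: "r \<in> {s<..b}" for r
  proof -
    have "y r < y s"
    proof (rule DERIV_neg_imp_decreasing_open[of s r])
      fix x assume "s < x" "x < r"
      then show "\<exists>l. (y has_real_derivative l) (at x) \<and> l < 0"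
        using y[of x] below[of x] lower[of x] interior[of x] in_T[of x] r by fastforce
    qed (use r b s in \<open>auto intro!: continuous_on_subset[OF cy]\<close>)
    then show ?thesis using \<open>y s \<le> c\<close> by linarith
  qed
  have "u b < u s"
  proof (rule DERIV_neg_imp_decreasing_open[of s b])
    fix x assume x: "s < x" "x < b"
    then have "v x < 0" using below[of x] lower[of x] in_T[of x] y_less[of x] by (auto simp: sgn_if split: if_splits)
    then show "\<exists>l. (u has_real_derivative l) (at x) \<and> l < 0"
      using u[of x] interior[of x] in_T[of x] x by fastforce
  qed (use b s in \<open>auto intro!: continuous_on_subset[OF cu]\<close>)
  then show False using t0(2)[OF in_T[of b]] s(2) b by auto
qed

theorem theorem4p1:
  fixes T \<alpha> :: real and p f g h :: "real \<Rightarrow> real"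
  assumes "T > 0"
    and "continuous_on {0..T} p" and "\<forall>t\<in>{0..T}. p t > 1" and "p 0 = p T"
    and "continuous_on {0..} f" and "continuous_on {0<..} g" and "continuous_on {0..T} h"
    and "\<alpha> > 0" and "g \<alpha> \<ge> (SUP t\<in>{0..T}. h t)"
    and "Limsup at_top (\<lambda>x. ereal (g x)) < ereal (mean_value T h)"
  shows "\<exists>u. periodic_solution T p f g h u \<and> (\<forall>t\<in>{0..T}. u t \<ge> \<alpha>)"
proof -
  note T = assms(1) and p = assms(2) and h = assms(7)
  have p1: "\<And>t. t \<in> {0..T} \<Longrightarrow> p t > 1" using assms(3) by blast
  obtain H where H: "H \<ge> 0" "\<And>t. t \<in> {0..T} \<Longrightarrow> \<bar>h t\<bar> \<le> H" using bounded_on_real[OF h] by blast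
  have h_le: "h t \<le> g \<alpha>" if "t \<in> {0..T}" for t
  proof -
    have "bdd_above (h ` {0..T})" using H(2) by (intro bdd_aboveI2[of _ _ H]) (auto simp: abs_le_iff)
    from cSUP_upper[OF that this] show ?thesis using assms(9) by linarith
  qed
  define f1 where "f1 x = f (max x \<alpha>)" for x
  have "continuous_on UNIV f1" unfolding f1_def
    by (intro continuous_on_compose2[OF assms(5)] continuous_intros) (use \<open>\<alpha> > 0\<close> in auto)
  then obtain G where G: "\<And>x. (G has_real_derivative f1 x) (at x)"
    using continuous_has_antiderivative by blast
  have contG: "continuous_on UNIV G"
    using G by (meson DERIV_continuous continuous_at_imp_continuous_on)
  define F where "F x = G (max x \<alpha>)" for x
  define q where "q x = g (max x \<alpha>) + max 0 (\<alpha> - x)" for x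
  have contF: "continuous_on UNIV F" unfolding F_def
    by (intro continuous_on_compose2[OF contG] continuous_intros) auto
  have contq: "continuous_on UNIV q" unfolding q_def
    by (intro continuous_on_compose2[OF assms(6)] continuous_intros) (use \<open>\<alpha> > 0\<close> in auto)
  obtain c where c: "Limsup at_top (\<lambda>x. ereal (g x)) < ereal c" "ereal c < ereal (mean_value T h)"
    using ereal_dense2[OF assms(10)] by blast
  obtain M0 where M0: "\<And>x. x \<ge> M0 \<Longrightarrow> g x < c"
    using Limsup_lessD[OF c(1)] by (auto simp: eventually_at_top_linorder)
  \<comment> \<open>For \<open>x \<le> - M\<close> the added term \<open>\<alpha> - x\<close> lifts \<open>q x\<close> above \<open>H + 1\<close>.\<close>
  define M where "M = max M0 (max \<alpha> (H + 1 + \<bar>g \<alpha>\<bar>))"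
  obtain u y where u: "u 0 = u T" and y: "y 0 = y T" and
    du: "\<And>t. t \<in> {0..T} \<Longrightarrow> (u has_real_derivative signed_powr (1 / (p t - 1)) (y t - F (u t))) (at t within {0..T})" and
    dy: "\<And>t. t \<in> {0..T} \<Longrightarrow> (y has_real_derivative h t - q (u t)) (at t within {0..T})"
  proof (rule lienard_system_periodic_solution[OF T p p1 h H(2) contF contq, of M "mean_value T h - c"])
    show "M \<ge> 0" using \<open>\<alpha> > 0\<close> by (simp add: M_def)
    show "mean_value T h - c > 0" using c(2) by simp
    show "q x \<le> mean_value T h - (mean_value T h - c)" if "x \<ge> M" for x
      using M0[of x] that by (simp add: q_def M_def)
    show "q x \<ge> H + 1" if "x \<le> - M" for x
      using that \<open>\<alpha> > 0\<close> H(1) by (simp add: q_def M_def max_def split: if_splits)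
  qed auto
  define v where "v t = signed_powr (1 / (p t - 1)) (y t - F (u t))" for t
  have v_per: "v 0 = v T" using u y assms(4) by (simp add: v_def)
  have ge: "u t \<ge> \<alpha>" if "t \<in> {0..T}" for t
  proof (rule periodic_minimum_principle[OF T _ dy u v_per _ that])
    show "(u has_real_derivative v t) (at t within {0..T})" if "t \<in> {0..T}" for t
      using du[OF that] by (simp add: v_def)
    show "h t - q (u t) < 0 \<and> sgn (v t) = sgn (y t - G \<alpha>)" if "t \<in> {0..T}" "u t < \<alpha>" for t
      using h_le[OF that(1)] that(2) by (auto simp: q_def v_def sgn_signed_powr F_def max_def)
  qed
  have cu: "continuous_on {0..T} u" and cy: "continuous_on {0..T} y"
    using du dy by (meson DERIV_continuous continuous_on_eq_continuous_within)+
  have cv: "continuous_on {0..T} v" unfolding v_def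
    by (intro continuous_on_signed_powr continuous_intros p cy continuous_on_compose2[OF contF cu]) (use p1 in fastforce)+
  have phi_v: "phi (p t) (v t) = y t - G (u t)" if "t \<in> {0..T}" for t
    using p1[OF that] ge[OF that] by (simp add: phi_eq_signed_powr v_def signed_powr_inverse F_def)
  define w where "w t = h t - g (u t) - f (u t) * v t" for t
  have dphi: "((\<lambda>t. phi (p t) (v t)) has_real_derivative w t) (at t within {0..T})" if t: "t \<in> {0..T}" for t
  proof -
    have "((\<lambda>t. y t - G (u t)) has_real_derivative (h t - q (u t)) - f1 (u t) * v t) (at t within {0..T})"
      using du[OF t] by (intro DERIV_diff dy t DERIV_chain'[OF _ G]) (simp add: v_def)
    moreover have "(h t - q (u t)) - f1 (u t) * v t = w t"
      using ge[OF t] by (simp add: q_def f1_def w_def)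
    ultimately have "((\<lambda>t. y t - G (u t)) has_real_derivative w t) (at t within {0..T})" by simp
    then show ?thesis
      by (rule has_field_derivative_transform_within[OF _ zero_less_one t]) (simp add: phi_v)
  qed
  have "continuous_on {0..T} (\<lambda>t. f (u t))" "continuous_on {0..T} (\<lambda>t. g (u t))"
    by (rule continuous_on_compose2[OF assms(5) cu] continuous_on_compose2[OF assms(6) cu];
        use ge \<open>\<alpha> > 0\<close> in fastforce)+
  then have cw: "continuous_on {0..T} w" unfolding w_def by (intro continuous_intros h cv)
  have "C1_with_deriv 0 T u v" "C1_with_deriv 0 T (\<lambda>t. phi (p t) (v t)) w"
    using du cv dphi cw by (auto simp: C1_with_deriv_def v_def)
  moreover have "\<forall>t\<in>{0..T}. w t + f (u t) * v t + g (u t) = h t" by (simp add: w_def)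
  moreover have "\<forall>t\<in>{0..T}. u t > 0" using ge \<open>\<alpha> > 0\<close> by fastforce
  ultimately have "periodic_solution T p f g h u"
    unfolding periodic_solution_def using u v_per by force
  then show ?thesis using ge by blast
qed

end
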